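(* For a suitable function $f=f(x)$ on $\mathbb{R}^n$, $$(R_{p,q}^k P_j^\alpha f)(\eta,v)=c\,(P_k^{q+\alpha}f)(\eta,v),\qquad c=\frac{2^q\pi^{q}\,\Gamma((n-k)/2)}{\Gamma((n-k-q)/2)},$$ provided that either side of this equality exists in the Lebesgue sense.
   Context: Standing assumptions: $n,p,q,l$ are integers with $p>0$, $q>0$, $l>0$, $p+q+l<n$; set $j=p+q$ and $k=p+l$. For a linear subspace $X\subset\mathbb{R}^n$, $G_m(X)$ is the set of $m$-dimensional linear subspaces of $X$ with its rotation-invariant probability measure; $G_{n,m}=G_m(\mathbb{R}^n)$. $G(n,m)$ is the set of all affine $m$-planes in $\mathbb{R}^n$; each element is written $(\xi,u)=\xi+u$ with $\xi\in G_{n,m}$, $u\in\xi^\perp$. For mutually orthogonal subspaces $P,Q$, $[P,Q]=P\oplus Q$. The Strichartz transform of a function $\varphi$ on $G(n,j)$ is the function on $G(n,k)$ $$(R_{p,q}^k \varphi)(\eta,v)=\int_{G_q(\eta^\perp)}dQ\int_{G_p(\eta)}dP\int_{P^\perp\cap\eta} \varphi([P,Q]+u+v)\,du,$$ with $dQ,dP$ the invariant probability measures. The Semyanistyi integral of a function $f$ on $\mathbb{R}^n$ is the function on $G(n,m)$ $$(P_m^{\alpha}f)(\zeta)=\frac{1}{\gamma_{n-m}(\alpha)}\int_{\mathbb{R}^n}f(x)\,|x-\zeta|^{\alpha+m-n}\,dx,\qquad \gamma_{n-m}(\alpha)=\frac{2^\alpha\pi^{(n-m)/2}\Gamma(\alpha/2)}{\Gamma((n-m-\alpha)/2)},$$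 where $|x-\zeta|$ is the Euclidean distance from the point $x$ to the plane $\zeta$, and $\mathrm{Re}\,\alpha>0$, $\alpha+m-n\ne0,2,4,\dots$. "Exists in the Lebesgue sense" means that the integral converges absolutely, i.e. it is finite with the function replaced by its absolute value.
   Formalization: The constant is corrected to c = 2^q π^{q/2} Γ((n-k)/2)/Γ((n-k-q)/2) (π^{q/2} in place of π^q), and existence of the right side is used only when Re α < n-k-q, since otherwise the left side diverges unless f = 0 a.e. *)

theory Defs
  imports "HOL-Analysis.Analysis" "HOL-Probability.Probability"
begin

definition grassmannian :: "(real^'n) set \<Rightarrow> nat \<Rightarrow> (real^'n) set set" where
  "grassmannian X m = {V. subspace V \<and> V \<subseteq> X \<and> dim V = m}"

(* For a subspace V, closest_point V is the orthogonal projection onto V. G_m(X) carries the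
   topology it gets from identifying V with the matrix of that projection. *)
definition grassmannian_borel :: "(real^'n) set \<Rightarrow> nat \<Rightarrow> (real^'n) set measure" where
  "grassmannian_borel X m =
     vimage_algebra (grassmannian X m) (\<lambda>V. matrix (closest_point V)) (borel :: (real^'n^'n) measure)"

(* M is the rotation-invariant Borel probability measure on G_m(X). Every orthogonal map of X
   is the restriction of some orthogonal map T of the whole space with T ` X = X. *)
definition invariant_grassmann_measure ::
    "(real^'n) set \<Rightarrow> nat \<Rightarrow> (real^'n) set measure \<Rightarrow> bool" where
  "invariant_grassmann_measure X m M \<longleftrightarrow>
     sets M = sets (grassmannian_borel X m) \<and> prob_space M \<and>
     (\<forall>T. orthogonal_transformation T \<longrightarrow> T ` X = X \<longrightarrow> distr M M (\<lambda>V. T ` V) = M)"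

(* Lebesgue measure du on a subspace X, in the coordinates of an orthonormal basis of X;
   the result does not depend on the basis. *)
definition subspace_lborel :: "(real^'n) set \<Rightarrow> (real^'n) measure" where
  "subspace_lborel X =
     (let B = (SOME B. B \<subseteq> X \<and> pairwise orthogonal B \<and> (\<forall>b\<in>B. norm b = 1) \<and> span B = X)
      in distr (\<Pi>\<^sub>M b\<in>B. lborel) borel (\<lambda>c. \<Sum>b\<in>B. c b *\<^sub>R b))"

(* The affine plane [P,Q] + w *)
definition join_plane :: "(real^'n) set \<Rightarrow> (real^'n) set \<Rightarrow> real^'n \<Rightarrow> (real^'n) set" where
  "join_plane P Q w = {x + y + w |x y. x \<in> P \<and> y \<in> Q}"

(* (R_{p,q}^k \<phi>)(\<eta>,v). Functions on G(n,j) are functions of the affine plane as a point set.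
   G X m stands for the invariant probability measure on G_m(X); k = dim \<eta>. *)
definition strichartz ::
    "((real^'n) set \<Rightarrow> nat \<Rightarrow> (real^'n) set measure) \<Rightarrow> nat \<Rightarrow> nat \<Rightarrow>
     ((real^'n) set \<Rightarrow> complex) \<Rightarrow> (real^'n) set \<Rightarrow> real^'n \<Rightarrow> complex" where
  "strichartz G p q \<phi> \<eta> v =
     (LINT Q|G (\<eta>\<^sup>\<bottom>) q. LINT P|G \<eta> p. LINT u|subspace_lborel (P\<^sup>\<bottom> \<inter> \<eta>). \<phi> (join_plane P Q (u + v)))"

(* The same integral for functions with values in [0,\<infinity>], to express absolute convergence *)
definition strichartz_nn ::
    "((real^'n) set \<Rightarrow> nat \<Rightarrow> (real^'n) set measure) \<Rightarrow> nat \<Rightarrow> nat \<Rightarrow>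
     ((real^'n) set \<Rightarrow> ennreal) \<Rightarrow> (real^'n) set \<Rightarrow> real^'n \<Rightarrow> ennreal" where
  "strichartz_nn G p q \<phi> \<eta> v =
     (\<integral>\<^sup>+Q. \<integral>\<^sup>+P. \<integral>\<^sup>+u. \<phi> (join_plane P Q (u + v)) \<partial>subspace_lborel (P\<^sup>\<bottom> \<inter> \<eta>) \<partial>G \<eta> p \<partial>G (\<eta>\<^sup>\<bottom>) q)"

definition riesz_gamma :: "nat \<Rightarrow> complex \<Rightarrow> complex" where
  "riesz_gamma d \<alpha> =
     2 powr \<alpha> * complex_of_real (pi powr (real d / 2)) * Gamma (\<alpha> / 2) / Gamma ((of_nat d - \<alpha>) / 2)"

definition semyanistyi_integrand ::
    "nat \<Rightarrow> complex \<Rightarrow> (real^'n \<Rightarrow> complex) \<Rightarrow> (real^'n) set \<Rightarrow> real^'n \<Rightarrow> complex" where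
  "semyanistyi_integrand m \<alpha> f \<zeta> x =
     f x * complex_of_real (infdist x \<zeta>) powr (\<alpha> + of_nat m - of_nat CARD('n))"

(* (P_m^\<alpha> f)(\<zeta>) *)
definition semyanistyi ::
    "nat \<Rightarrow> complex \<Rightarrow> (real^'n \<Rightarrow> complex) \<Rightarrow> (real^'n) set \<Rightarrow> complex" where
  "semyanistyi m \<alpha> f \<zeta> =
     1 / riesz_gamma (CARD('n) - m) \<alpha> * (LINT x|lebesgue. semyanistyi_integrand m \<alpha> f \<zeta> x)"

(* The integral of the absolute value, without the nonzero factor 1 / riesz_gamma *)
definition semyanistyi_nn ::
    "nat \<Rightarrow> complex \<Rightarrow> (real^'n \<Rightarrow> complex) \<Rightarrow> (real^'n) set \<Rightarrow> ennreal" where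
  "semyanistyi_nn m \<alpha> f \<zeta> =
     (\<integral>\<^sup>+x. ennreal (norm (semyanistyi_integrand m \<alpha> f \<zeta> x)) \<partial>lebesgue)"

(* Admissible exponents: Re \<alpha> > 0 and \<alpha> + m - n is none of 0, 2, 4, ... *)
definition semyanistyi_admissible :: "nat \<Rightarrow> nat \<Rightarrow> complex \<Rightarrow> bool" where
  "semyanistyi_admissible n m \<alpha> \<longleftrightarrow>
     Re \<alpha> > 0 \<and> (\<forall>i::nat. \<alpha> + of_nat m - of_nat n \<noteq> 2 * of_nat i)"

end

theory Submission
  imports Defs
begin

text \<open>
Write \<open>b = \<alpha> + j - n\<close> for the exponent of the distance in the integral \<open>P_j^\<alpha> f\<close>. All of the
identity comes from integrating the kernel \<open>|x - ([P,Q] + u + v)|^b\<close> over \<open>u\<close>, \<open>P\<close> and \<open>Q\<close> for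
a fixed point \<open>x\<close>, after \<open>f(x) dx\<close> has been moved outside.

Let \<open>a\<close> be the projection of \<open>x\<close> to \<open>P\<^sup>\<bottom> \<inter> \<eta>\<close>, let \<open>y\<close> be the component of \<open>x - v\<close> in \<open>\<eta>\<^sup>\<bottom>\<close>, and
\<open>s\<close> the distance of \<open>y\<close> from \<open>Q\<close>. By Pythagoras the squared distance of \<open>x\<close> from \<open>[P,Q] + u + v\<close>
is \<open>|u - a|^2 + s^2\<close> (\<open>infdist_plane\<close>, \<open>plane_dist_eq\<close>). In polar coordinates of the
\<open>l\<close>-dimensional space \<open>P\<^sup>\<bottom> \<inter> \<eta>\<close> the integral over \<open>u\<close> is a Beta integral of the second kind, equal
to a constant times \<open>s^(b+l)\<close> if \<open>Re b + l < 0\<close> (\<open>has_bochner_integral_fibre\<close>). The result no longer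
depends on \<open>P\<close>, so the average over \<open>P\<close> disappears. The average over \<open>Q\<close> of \<open>s^(b+l)\<close> is rotation
invariant and homogeneous in \<open>y\<close>, hence a constant times \<open>|y|^(b+l)\<close>, and integration against a
Gaussian finds the constant (\<open>has_bochner_integral_average\<close>). Finally \<open>|y|\<close> is the distance of \<open>x\<close>
from \<open>\<eta> + v\<close> and \<open>b + l = (q + \<alpha>) + k - n\<close>, so what is left is the integral in
\<open>P_k^(q+\<alpha>) f\<close>; the Gamma factors are collected in \<open>normalising_constants\<close>.

With \<open>|f|\<close> and \<open>Re \<alpha>\<close> in place of \<open>f\<close> and \<open>\<alpha>\<close> the same computation uses only Tonelli's theorem and
relates the two absolute integrals by a finite positive factor (\<open>strichartz_nn_eq\<close>). This proves that
each is finite if the other is, and then justifies Fubini's theorem for the complex integrals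
(\<open>strichartz_eq\<close>). If \<open>Re b + l \<ge> 0\<close>, which is to say \<open>Re \<alpha> \<ge> n - k - q\<close>, the integral over \<open>u\<close>
diverges for every \<open>x\<close>; the transform can then converge absolutely only if \<open>f\<close> vanishes almost
everywhere, and both sides are \<open>0\<close> (\<open>AE_zero_if_strichartz_nn_finite\<close>). Convergence of the right
side gives no information there, hence the bound on \<open>Re \<alpha>\<close> in the second alternative of the hypothesis.

The measure on a subspace \<open>X\<close> is handled as the image under the orthogonal projection of Lebesgue
measure on the whole space with a Gaussian weight in the directions orthogonal to \<open>X\<close>
(\<open>nn_integral_subspace_lborel\<close>). No basis occurs in this description, and it depends on \<open>X\<close> through
its projection only; so integrals over \<open>P\<^sup>\<bottom> \<inter> \<eta>\<close> become integrals over one fixed measure space, with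
an integrand that is visibly measurable in \<open>P\<close>.
\<close>

section \<open>Orthogonal projections and distances to planes\<close>

abbreviation proj :: "'a::euclidean_space set \<Rightarrow> 'a \<Rightarrow> 'a" where
  "proj \<equiv> closest_point"

lemma proj_eqI:
  assumes V: "subspace V" and y: "y \<in> V" and orth: "\<And>z. z \<in> V \<Longrightarrow> (x - y) \<bullet> z = 0"
  shows "proj V x = y"
proof (rule closest_point_unique[symmetric])
  show "\<forall>z\<in>V. dist x y \<le> dist x z"
  proof
    fix z assume z: "z \<in> V"
    have "(x - y) \<bullet> (y - z) = 0" using orth V y z by (simp add: subspace_diff)
    then have "(norm (x - z))\<^sup>2 = (norm (x - y))\<^sup>2 + (norm (y - z))\<^sup>2"
      by (simp add: power2_norm_eq_inner algebra_simps inner_commute)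
    then have "(norm (x - y))\<^sup>2 \<le> (norm (x - z))\<^sup>2" by simp
    then show "dist x y \<le> dist x z" by (simp add: dist_norm power2_le_iff_abs_le)
  qed
qed (use assms in \<open>auto simp: subspace_imp_convex closed_subspace\<close>)

lemma proj_in:
  assumes "subspace V" shows "proj V x \<in> V"
  using assms by (intro closest_point_in_set closed_subspace) (use subspace_0 in blast)+

lemma proj_orth:
  assumes V: "subspace V" and z: "z \<in> V"
  shows "(x - proj V x) \<bullet> z = 0"
proof -
  obtain y w where yw: "y \<in> span V" "\<And>z. z \<in> span V \<Longrightarrow> orthogonal w z" "x = y + w"
    using orthogonal_subspace_decomp_exists by blast
  have "proj V x = y"
    by (rule proj_eqI) (use V yw in \<open>auto simp: orthogonal_def span_eq_iff[THEN iffD2]\<close>)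
  then show ?thesis using yw z by (simp add: orthogonal_def span_base)
qed

lemma proj_inner:
  assumes "subspace V" "z \<in> V" shows "proj V x \<bullet> z = x \<bullet> z"
  using proj_orth[OF assms, of x] by (simp add: inner_diff_left)

lemma linear_proj:
  assumes V: "subspace V" shows "linear (proj V)"
proof
  fix x y :: 'a and c :: real
  show "proj V (x + y) = proj V x + proj V y"
    by (rule proj_eqI) (use V in \<open>auto simp: proj_in subspace_add inner_add_left inner_diff_left proj_inner\<close>)
  show "proj V (c *\<^sub>R x) = c *\<^sub>R proj V x"
    by (rule proj_eqI) (use V in \<open>auto simp: proj_in subspace_scale inner_diff_left proj_inner\<close>)
qed

lemma proj_add: "subspace V \<Longrightarrow> proj V (x + y) = proj V x + proj V y"
  and proj_diff: "subspace V \<Longrightarrow> proj V (x - y) = proj V x - proj V y"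
  and proj_scaleR: "subspace V \<Longrightarrow> proj V (c *\<^sub>R x) = c *\<^sub>R proj V x"
  using linear_proj linear_add linear_diff linear_scale by blast+

lemma proj_measurable: "subspace V \<Longrightarrow> proj V \<in> borel_measurable borel"
  using linear_proj by (intro borel_measurable_continuous_onI linear_continuous_on) (simp add: linear_linear)

lemma proj_ident: "subspace V \<Longrightarrow> x \<in> V \<Longrightarrow> proj V x = x"
  by (simp add: closest_point_self)

lemma proj_orthogonal_comp_eq_0: "subspace V \<Longrightarrow> x \<in> V\<^sup>\<bottom> \<Longrightarrow> proj V x = 0"
  by (rule proj_eqI) (auto simp: subspace_0 orthogonal_comp_def orthogonal_def inner_commute)

lemma norm_proj_pythagoras:
  assumes "subspace V"
  shows "(norm x)\<^sup>2 = (norm (proj V x))\<^sup>2 + (norm (x - proj V x))\<^sup>2"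
  using proj_orth[OF assms proj_in[OF assms], of x x]
  by (simp add: power2_norm_eq_inner algebra_simps inner_commute)

lemma proj_orthogonal_comp:
  assumes "subspace V"
  shows "proj (V\<^sup>\<bottom>) x = x - proj V x"
proof (rule proj_eqI[OF subspace_orthogonal_comp])
  show "x - proj V x \<in> V\<^sup>\<bottom>"
    using proj_orth[OF assms] by (auto simp: orthogonal_comp_def orthogonal_def inner_commute)
  show "(x - (x - proj V x)) \<bullet> z = 0" if "z \<in> V\<^sup>\<bottom>" for z
    using that proj_in[OF assms, of x] by (auto simp: orthogonal_comp_def orthogonal_def)
qed

lemma proj_relative_complement:
  assumes W: "subspace W" and X: "subspace X" and WX: "W \<subseteq> X"
  shows "proj (W\<^sup>\<bottom> \<inter> X) x = proj X x - proj W x"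
proof (rule proj_eqI)
  show "subspace (W\<^sup>\<bottom> \<inter> X)" using X by (simp add: subspace_inter subspace_orthogonal_comp)
  have "(proj X x - proj W x) \<bullet> w = 0" if "w \<in> W" for w
    using that WX by (auto simp: inner_diff_left proj_inner W X)
  then show "proj X x - proj W x \<in> W\<^sup>\<bottom> \<inter> X"
    using WX proj_in[OF W, of x] proj_in[OF X, of x] X
    by (auto simp: orthogonal_comp_def orthogonal_def inner_commute subspace_diff)
next
  fix z assume z: "z \<in> W\<^sup>\<bottom> \<inter> X"
  then have "proj W x \<bullet> z = 0" using proj_in[OF W, of x]
    by (auto simp: orthogonal_comp_def orthogonal_def)
  then show "(x - (proj X x - proj W x)) \<bullet> z = 0"
    using z by (simp add: inner_diff_left proj_inner X)
qed

lemma dim_relative_complement: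
  fixes X :: "(real^'n) set"
  assumes W: "subspace W" and X: "subspace X" and WX: "W \<subseteq> X"
  shows "dim (W\<^sup>\<bottom> \<inter> X) = dim X - dim W"
proof -
  have "dim {y \<in> X. \<forall>x \<in> W. orthogonal x y} + dim W = dim X"
    using dim_subspace_orthogonal_to_vectors[OF W X WX] .
  moreover have "{y \<in> X. \<forall>x \<in> W. orthogonal x y} = W\<^sup>\<bottom> \<inter> X"
    by (auto simp: orthogonal_comp_def)
  ultimately show ?thesis by simp
qed

lemma infdist_subspace:
  assumes "subspace V"
  shows "infdist x V = norm (x - proj V x)"
proof -
  have "V \<noteq> {}" "closed V" using assms subspace_0 closed_subspace by auto
  then have "infdist x V = dist x (proj V x)"
    by (metis setdist_closest_point infdist_eq_setdist)
  then show ?thesis by (simp add: dist_norm)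
qed

lemma infdist_translate:
  fixes x :: "'a::real_normed_vector"
  shows "infdist x ((+) w ` S) = infdist (x - w) S"
  by (simp add: infdist_def dist_norm image_image diff_diff_eq)

lemma infdist_affine_subspace:
  "subspace V \<Longrightarrow> infdist x ((+) w ` V) = norm ((x - w) - proj V (x - w))"
  by (simp add: infdist_translate infdist_subspace)

text \<open>The subspaces are orthogonal, so the projection to their sum is the sum of the projections. This
form of the distance makes sense, and is measurable, for all arguments at once.\<close>
lemma infdist_join_plane:
  assumes P: "subspace P" and Q: "subspace Q" and QP: "Q \<subseteq> P\<^sup>\<bottom>"
  shows "infdist x (join_plane P Q w) = norm ((x - w) - proj P (x - w) - proj Q (x - w))"
proof -
  define S where "S = {a + b | a b. a \<in> P \<and> b \<in> Q}"
  have S: "subspace S" unfolding S_def using P Q by (rule subspace_sums)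
  have "join_plane P Q w = (+) w ` S"
    by (auto simp: join_plane_def S_def image_def) (metis add.commute)+
  moreover have "proj S y = proj P y + proj Q y" for y
  proof (rule proj_eqI[OF S])
    show "proj P y + proj Q y \<in> S" unfolding S_def using proj_in[OF P] proj_in[OF Q] by blast
    fix z assume "z \<in> S"
    then obtain a b where ab: "z = a + b" "a \<in> P" "b \<in> Q" by (auto simp: S_def)
    have "proj P y \<bullet> b = 0" "proj Q y \<bullet> a = 0"
      using ab QP proj_in[OF P, of y] proj_in[OF Q, of y]
      by (auto simp: orthogonal_comp_def orthogonal_def inner_commute)
    then show "(y - (proj P y + proj Q y)) \<bullet> z = 0"
      using ab by (simp add: inner_add_right inner_diff_left inner_add_left proj_inner P Q)
  qed
  ultimately show ?thesis using infdist_affine_subspace[OF S, of x w] by (simp add: algebra_simps)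
qed

lemma proj_orthogonal_image:
  assumes T: "orthogonal_transformation T" and V: "subspace V"
  shows "proj (T ` V) (T x) = T (proj V x)"
proof (rule proj_eqI)
  have lin: "linear T" by (rule orthogonal_transformation_linear[OF T])
  show "subspace (T ` V)" using lin V by (rule linear_subspace_image)
  show "T (proj V x) \<in> T ` V" using proj_in[OF V] by blast
  fix z assume "z \<in> T ` V"
  then show "(T x - T (proj V x)) \<bullet> z = 0"
    using T lin proj_orth[OF V]
    by (auto simp: orthogonal_transformation_def linear_diff[symmetric])
qed

text \<open>The Householder reflection along \<open>y - y'\<close> exchanges the two vectors, and it maps \<open>E\<close> to itself
because it only adds multiples of a vector of \<open>E\<close>.\<close>
lemma exists_reflection_in_subspace:
  fixes y y' :: "'a::euclidean_space"
  assumes E: "subspace E" and y: "y \<in> E" "y' \<in> E" and n: "norm y = norm y'"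
  obtains T where "orthogonal_transformation T" "T ` E = E" "T y = y'"
proof (cases "y = y'")
  case True
  show ?thesis using that[of "\<lambda>x. x"] True by simp
next
  case False
  define w where "w = y - y'"
  have w: "w \<bullet> w \<noteq> 0" using False by (simp add: w_def)
  define T where "T x = x - (2 * (x \<bullet> w) / (w \<bullet> w)) *\<^sub>R w" for x
  have lin: "linear T"
    by standard (auto simp: T_def inner_add_left algebra_simps add_divide_distrib)
  have inn: "T a \<bullet> T b = a \<bullet> b" for a b
    using w by (simp add: T_def inner_diff_left inner_diff_right inner_commute field_simps)
  have TT: "T (T x) = x" for x
    using w by (simp add: T_def inner_diff_left algebra_simps)
  have TE: "T x \<in> E" if "x \<in> E" for x
    unfolding T_def w_def using that y E by (intro subspace_diff subspace_scale) auto
  have "y \<bullet> y = y' \<bullet> y'" using n by (simp add: norm_eq)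
  then have "w \<bullet> w = 2 * (y \<bullet> w)"
    by (simp add: w_def inner_diff_left inner_diff_right inner_commute)
  then have "T y = y'" using w by (simp add: T_def w_def)
  moreover have "T ` E = E" using TE TT by (metis image_subset_iff subsetI subset_antisym image_eqI)
  moreover have "orthogonal_transformation T" using lin inn by (simp add: orthogonal_transformation_def)
  ultimately show ?thesis using that by blast
qed

section \<open>Rotation invariance of Lebesgue measure\<close>

lemma nn_integral_gaussian_real: "(\<integral>\<^sup>+x. ennreal (exp (- x\<^sup>2)) \<partial>(lborel :: real measure)) = ennreal (sqrt pi)"
proof -
  have "has_bochner_integral lborel (\<lambda>x::real. exp (- x\<^sup>2)) (2 * (sqrt pi / 2))"
    using has_bochner_integral_even_function[OF gaussian_moment_0] by simp
  then show ?thesis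
    by (subst nn_integral_eq_integral) (auto simp: has_bochner_integral_iff)
qed

lemma nn_integral_gaussian_coordinates:
  assumes "finite C"
  shows "(\<integral>\<^sup>+c. ennreal (exp (- (\<Sum>i\<in>C. (c i)\<^sup>2))) \<partial>(\<Pi>\<^sub>M i\<in>C. lborel)) = ennreal (sqrt pi ^ card C)"
proof -
  interpret product_sigma_finite "\<lambda>_. lborel :: real measure" ..
  have "(\<integral>\<^sup>+c. ennreal (exp (- (\<Sum>i\<in>C. (c i)\<^sup>2))) \<partial>(\<Pi>\<^sub>M i\<in>C. lborel)) =
        (\<integral>\<^sup>+c. (\<Prod>i\<in>C. ennreal (exp (- (c i)\<^sup>2))) \<partial>(\<Pi>\<^sub>M i\<in>C. lborel))"
    using assms by (simp add: prod_ennreal exp_sum sum_negf[symmetric])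
  also have "\<dots> = (\<Prod>i\<in>C. \<integral>\<^sup>+x. ennreal (exp (- x\<^sup>2)) \<partial>lborel)"
    using assms by (intro product_nn_integral_prod) auto
  finally show ?thesis by (simp add: nn_integral_gaussian_real ennreal_power)
qed

lemma nn_integral_gaussian:
  "(\<integral>\<^sup>+x. ennreal (exp (- (norm x)\<^sup>2)) \<partial>(lborel :: 'a::euclidean_space measure)) = ennreal (sqrt pi ^ DIM('a))"
proof -
  have "(norm (\<Sum>b\<in>Basis. c b *\<^sub>R b :: 'a))\<^sup>2 = (\<Sum>b\<in>Basis. (c b)\<^sup>2)" for c
    by (subst power2_norm_eq_inner, subst euclidean_inner) (simp add: power2_eq_square)
  then show ?thesis
    by (subst lborel_eq) (simp add: nn_integral_distr nn_integral_gaussian_coordinates)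
qed

lemma nn_integral_lborel_translate:
  fixes h :: "'a::euclidean_space \<Rightarrow> ennreal"
  assumes "h \<in> borel_measurable borel"
  shows "(\<integral>\<^sup>+x. h (c + x) \<partial>lborel) = (\<integral>\<^sup>+x. h x \<partial>lborel)"
  using assms nn_integral_distr[of "(+) c" lborel borel h] by (simp add: lborel_distr_plus)

text \<open>This is the uniqueness proof for Haar measure. With \<open>g\<close> a Gaussian, which is invariant under \<open>T\<close>,
both \<open>(\<integral> f \<circ> T) * (\<integral> g)\<close> and \<open>(\<integral> f) * (\<integral> g)\<close> are values of the same double integral, by translation
invariance in one variable at a time.\<close>
lemma lborel_orthogonal_invariant:
  fixes T :: "'a::euclidean_space \<Rightarrow> 'a"
  assumes T: "orthogonal_transformation T"
  shows "distr lborel borel T = lborel"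
proof (rule measure_eqI)
  have lin: "linear T" using T by (rule orthogonal_transformation_linear)
  have [measurable]: "T \<in> borel_measurable borel"
    using lin by (intro borel_measurable_continuous_onI linear_continuous_on) (simp add: linear_linear)
  define g :: "'a \<Rightarrow> ennreal" where "g y = ennreal (exp (- (norm y)\<^sup>2))" for y
  have [measurable]: "g \<in> borel_measurable borel" unfolding g_def by measurable
  define c where "c = (\<integral>\<^sup>+y. g y \<partial>(lborel :: 'a measure))"
  have c: "c \<noteq> 0" "c \<noteq> \<infinity>" by (simp_all add: c_def g_def nn_integral_gaussian)
  fix A assume "A \<in> sets (distr lborel borel T)"
  then have [measurable]: "A \<in> sets borel" by simp
  define f :: "'a \<Rightarrow> ennreal" where "f = indicator A"
  have [measurable]: "f \<in> borel_measurable borel" unfolding f_def by measurable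
  have gT: "g (T x) = g x" for x
    using orthogonal_transformation_norm[OF T] by (simp add: g_def)
  have "(\<integral>\<^sup>+x. f (T x) \<partial>lborel) * c = (\<integral>\<^sup>+x. f (T x) * (\<integral>\<^sup>+y. g (- T x + y) \<partial>lborel) \<partial>lborel)"
    by (subst nn_integral_lborel_translate) (simp_all add: nn_integral_multc c_def)
  also have "\<dots> = (\<integral>\<^sup>+x. \<integral>\<^sup>+y. f (T x) * g (- T x + y) \<partial>lborel \<partial>lborel)"
    by (simp add: nn_integral_cmult)
  also have "\<dots> = (\<integral>\<^sup>+y. \<integral>\<^sup>+x. f (T x) * g (- T x + y) \<partial>lborel \<partial>lborel)"
    by (rule lborel_pair.Fubini') measurable
  also have "\<dots> = (\<integral>\<^sup>+y. \<integral>\<^sup>+x. f (y + T x) * g x \<partial>lborel \<partial>lborel)"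
  proof (rule nn_integral_cong)
    fix y
    obtain z where z: "T z = y" using orthogonal_transformation_surj[OF T] by (metis surjD)
    have "(\<integral>\<^sup>+x. f (T x) * g (- T x + y) \<partial>lborel) = (\<integral>\<^sup>+x. f (T (z + x)) * g (- T (z + x) + y) \<partial>lborel)"
      by (rule nn_integral_lborel_translate[symmetric]) measurable
    also have "\<dots> = (\<integral>\<^sup>+x. f (y + T x) * g x \<partial>lborel)"
    proof (rule nn_integral_cong)
      fix x
      have "g (- T (z + x) + y) = g (T x)" by (simp add: linear_add[OF lin] z g_def)
      then show "f (T (z + x)) * g (- T (z + x) + y) = f (y + T x) * g x"
        by (simp add: gT linear_add[OF lin] z)
    qed
    finally show "(\<integral>\<^sup>+x. f (T x) * g (- T x + y) \<partial>lborel) = (\<integral>\<^sup>+x. f (y + T x) * g x \<partial>lborel)" .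
  qed
  also have "\<dots> = (\<integral>\<^sup>+x. \<integral>\<^sup>+y. f (T x + y) * g x \<partial>lborel \<partial>lborel)"
    by (subst lborel_pair.Fubini') (simp_all add: add.commute)
  also have "\<dots> = (\<integral>\<^sup>+x. f x \<partial>lborel) * c"
    by (simp add: nn_integral_multc nn_integral_cmult nn_integral_lborel_translate c_def)
  finally have "(\<integral>\<^sup>+x. f (T x) \<partial>lborel) = (\<integral>\<^sup>+x. f x \<partial>lborel)"
    using c by (auto simp: ennreal_mult_cancel_left mult.commute[of _ c])
  then show "emeasure (distr lborel borel T) A = emeasure lborel A"
    using nn_integral_distr[of T lborel borel f] by (simp add: f_def)
qed simp

lemma distr_PiM_reindex_finite:
  assumes M: "sigma_finite_measure M" and A: "finite A" and bij: "bij_betw \<sigma> A B"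
  shows "distr (\<Pi>\<^sub>M b\<in>B. M) (\<Pi>\<^sub>M a\<in>A. M) (\<lambda>c. \<lambda>a\<in>A. c (\<sigma> a)) = (\<Pi>\<^sub>M a\<in>A. M)"
proof -
  interpret product_sigma_finite "\<lambda>_. M" using M by (simp add: product_sigma_finite_def)
  have B: "finite B" using bij A bij_betw_finite by blast
  have meas: "(\<lambda>c. \<lambda>a\<in>A. c (\<sigma> a)) \<in> (\<Pi>\<^sub>M b\<in>B. M) \<rightarrow>\<^sub>M (\<Pi>\<^sub>M a\<in>A. M)"
    using bij by (intro measurable_restrict measurable_component_singleton) (auto simp: bij_betw_def)
  show ?thesis
  proof (rule PiM_eqI[OF A])
    fix S assume S: "\<And>i. i \<in> A \<Longrightarrow> S i \<in> sets M"
    define \<tau> where "\<tau> = the_inv_into A \<sigma>"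
    have \<tau>: "\<tau> (\<sigma> a) = a" if "a \<in> A" for a
      using that bij by (simp add: \<tau>_def bij_betw_def the_inv_into_f_f)
    have \<sigma>: "B = \<sigma> ` A" "inj_on \<sigma> A" using bij by (auto simp: bij_betw_def)
    have "(\<lambda>c. \<lambda>a\<in>A. c (\<sigma> a)) -` (\<Pi>\<^sub>E a\<in>A. S a) \<inter> space (\<Pi>\<^sub>M b\<in>B. M) = (\<Pi>\<^sub>E b\<in>B. S (\<tau> b))"
      using S[THEN sets.sets_into_space]
      by (auto simp: space_PiM PiE_iff \<sigma> \<tau> extensional_def) blast
    then have "emeasure (distr (\<Pi>\<^sub>M b\<in>B. M) (\<Pi>\<^sub>M a\<in>A. M) (\<lambda>c. \<lambda>a\<in>A. c (\<sigma> a))) (\<Pi>\<^sub>E a\<in>A. S a)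
      = emeasure (\<Pi>\<^sub>M b\<in>B. M) (\<Pi>\<^sub>E b\<in>B. S (\<tau> b))"
      using S A by (subst emeasure_distr[OF meas]) auto
    also have "\<dots> = (\<Prod>b\<in>B. emeasure M (S (\<tau> b)))"
      using B S by (intro emeasure_PiM) (auto simp: \<sigma> \<tau>)
    also have "\<dots> = (\<Prod>a\<in>A. emeasure M (S a))"
      by (simp add: \<sigma> prod.reindex \<tau>)
    finally show "emeasure (distr (\<Pi>\<^sub>M b\<in>B. M) (\<Pi>\<^sub>M a\<in>A. M) (\<lambda>c. \<lambda>a\<in>A. c (\<sigma> a))) (\<Pi>\<^sub>E a\<in>A. S a)
      = (\<Prod>a\<in>A. emeasure M (S a))" .
  qed simp
qed

lemma orthonormal_sum_inner:
  assumes "finite B" "pairwise orthogonal B" "\<And>b. b \<in> B \<Longrightarrow> norm b = 1"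
  shows "(\<Sum>b\<in>B. c b *\<^sub>R b) \<bullet> (\<Sum>b\<in>B. d b *\<^sub>R b) = (\<Sum>b\<in>B. c b * d b)"
proof -
  have "(\<Sum>b\<in>B. c b *\<^sub>R b) \<bullet> (\<Sum>b\<in>B. d b *\<^sub>R b) = (\<Sum>b\<in>B. \<Sum>b'\<in>B. c b * d b' * (b \<bullet> b'))"
    by (simp add: inner_sum_left inner_sum_right sum_distrib_left mult_ac) (rule sum.swap)
  also have "\<dots> = (\<Sum>b\<in>B. \<Sum>b'\<in>B. if b = b' then c b * d b else 0)"
    using assms by (intro sum.cong refl) (auto simp: pairwise_def orthogonal_def norm_eq_1)
  finally show ?thesis using assms by simp
qed

text \<open>Lebesgue measure is the product measure in the standard coordinates; an orthogonal map takes the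
standard basis to \<open>B\<close>.\<close>
lemma lborel_orthonormal_basis:
  fixes B :: "'a::euclidean_space set"
  assumes B: "pairwise orthogonal B" "\<And>b. b \<in> B \<Longrightarrow> norm b = 1" "span B = UNIV"
  shows "distr (\<Pi>\<^sub>M b\<in>B. lborel) borel (\<lambda>c. \<Sum>b\<in>B. c b *\<^sub>R b) = lborel"
proof -
  have ind: "independent B"
    using B(1) B(2)[of 0] by (intro pairwise_orthogonal_independent) auto
  then have fin: "finite B" by (rule independent_imp_finite)
  have "card B = DIM('a)" using B ind by (metis dim_UNIV dim_eq_card_independent dim_span)
  then obtain \<sigma> where \<sigma>: "bij_betw \<sigma> (Basis :: 'a set) B"
    using fin finite_same_card_bij[OF finite_Basis, of B] by auto
  define T where "T x = (\<Sum>i\<in>Basis. (x \<bullet> i) *\<^sub>R \<sigma> i)" for x :: 'a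
  define \<tau> where "\<tau> = the_inv_into Basis \<sigma>"
  have \<tau>: "\<tau> (\<sigma> a) = a" if "a \<in> Basis" for a
    using that \<sigma> by (simp add: \<tau>_def bij_betw_def the_inv_into_f_f)
  have T': "T x = (\<Sum>b\<in>B. (x \<bullet> \<tau> b) *\<^sub>R b)" for x
    unfolding T_def by (subst sum.reindex_bij_betw[OF \<sigma>, symmetric]) (simp add: \<tau>)
  have "T x \<bullet> T y = x \<bullet> y" for x y
    unfolding T' using fin B
    by (subst orthonormal_sum_inner)
      (auto simp: sum.reindex_bij_betw[OF \<sigma>, symmetric] \<tau> euclidean_inner[of x y])
  moreover have "linear T"
    by standard (auto simp: T_def inner_add_left algebra_simps sum.distrib scaleR_sum_right)
  ultimately have T: "orthogonal_transformation T" by (simp add: orthogonal_transformation_def)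
  have [measurable]: "T \<in> borel_measurable borel" unfolding T_def by measurable
  have T_sum: "T (\<Sum>i\<in>Basis. (\<lambda>a\<in>Basis. c (\<sigma> a)) i *\<^sub>R i) = (\<Sum>b\<in>B. c b *\<^sub>R b)" for c
    unfolding T_def by (subst sum.reindex_bij_betw[OF \<sigma>, symmetric]) simp
  have meas: "(\<lambda>c. \<lambda>a\<in>Basis. c (\<sigma> a)) \<in> (\<Pi>\<^sub>M b\<in>B. lborel) \<rightarrow>\<^sub>M (\<Pi>\<^sub>M a\<in>(Basis::'a set). lborel :: real measure)"
    using \<sigma> by (intro measurable_restrict measurable_component_singleton) (auto simp: bij_betw_def)
  have "lborel = distr lborel borel T" using lborel_orthogonal_invariant[OF T] by simp
  also have "\<dots> = distr (distr (\<Pi>\<^sub>M b\<in>Basis. lborel) borel (\<lambda>f. \<Sum>b\<in>Basis. f b *\<^sub>R b)) borel T"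
    by (subst lborel_eq) simp
  also have "\<dots> = distr (\<Pi>\<^sub>M b\<in>Basis. lborel) borel (\<lambda>f. T (\<Sum>b\<in>Basis. f b *\<^sub>R b))"
    by (subst distr_distr) (auto simp: comp_def)
  also have "\<dots> = distr (distr (\<Pi>\<^sub>M b\<in>B. lborel) (\<Pi>\<^sub>M b\<in>Basis. lborel) (\<lambda>c. \<lambda>a\<in>Basis. c (\<sigma> a))) borel
     (\<lambda>f. T (\<Sum>b\<in>Basis. f b *\<^sub>R b))"
    by (simp add: distr_PiM_reindex_finite[OF sigma_finite_lborel finite_Basis \<sigma>])
  also have "\<dots> = distr (\<Pi>\<^sub>M b\<in>B. lborel) borel (\<lambda>c. T (\<Sum>b\<in>Basis. (\<lambda>a\<in>Basis. c (\<sigma> a)) b *\<^sub>R b))"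
    by (subst distr_distr[OF _ meas]) (auto simp: comp_def)
  also have "\<dots> = distr (\<Pi>\<^sub>M b\<in>B. lborel) borel (\<lambda>c. \<Sum>b\<in>B. c b *\<^sub>R b)"
    by (simp only: T_sum)
  finally show ?thesis by simp
qed

section \<open>Lebesgue measure on a subspace\<close>

text \<open>A Gaussian density on the orthogonal complement of \<open>X\<close>, normalised to total mass \<open>1\<close>.\<close>
definition gauss_weight :: "(real^'n) set \<Rightarrow> real^'n \<Rightarrow> real" where
  "gauss_weight X w = exp (- (norm (w - proj X w))\<^sup>2) / sqrt pi ^ (CARD('n) - dim X)"

lemma gauss_weight_nonneg: "0 \<le> gauss_weight X w"
  by (simp add: gauss_weight_def)

lemma gauss_weight_measurable [measurable]:
  "subspace X \<Longrightarrow> gauss_weight X \<in> borel_measurable borel"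
  using proj_measurable[of X] unfolding gauss_weight_def by measurable

lemma sets_subspace_lborel [simp, measurable_cong]: "sets (subspace_lborel X) = sets borel"
  by (simp add: subspace_lborel_def Let_def)

lemma space_subspace_lborel [simp]: "space (subspace_lborel X) = UNIV"
  by (simp add: subspace_lborel_def Let_def)

text \<open>Names the basis that the definition of \<open>subspace_lborel\<close> leaves to a choice.\<close>
lemma subspace_lborel_orthonormal_basis:
  fixes X :: "(real^'n) set"
  assumes "subspace X"
  obtains B where "finite B" "B \<subseteq> X" "pairwise orthogonal B" "\<And>b. b \<in> B \<Longrightarrow> norm b = 1"
    "span B = X" "card B = dim X"
    "subspace_lborel X = distr (\<Pi>\<^sub>M b\<in>B. lborel) borel (\<lambda>c. \<Sum>b\<in>B. c b *\<^sub>R b)"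
proof -
  define good where "good B \<longleftrightarrow> B \<subseteq> X \<and> pairwise orthogonal B \<and> (\<forall>b\<in>B. norm b = 1) \<and> span B = X" for B
  define B where "B = (SOME B. good B)"
  have "\<exists>B. good B"
    using orthonormal_basis_subspace[OF assms] unfolding good_def by metis
  then have good: "good B" unfolding B_def by (rule someI_ex)
  then have "0 \<notin> B" by (auto simp: good_def)
  then have ind: "independent B" using good pairwise_orthogonal_independent by (auto simp: good_def)
  moreover have "card B = dim X"
    using good ind dim_eq_card_independent[OF ind] by (metis dim_span good_def)
  moreover have "subspace_lborel X = distr (\<Pi>\<^sub>M b\<in>B. lborel) borel (\<lambda>c. \<Sum>b\<in>B. c b *\<^sub>R b)"
    by (simp add: subspace_lborel_def B_def good_def Let_def)
  ultimately show ?thesis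
    using that[of B] good independent_imp_finite[OF ind] by (auto simp: good_def)
qed

text \<open>In coordinates of an orthonormal basis of \<open>X\<close> completed to one of the whole space, the weight
depends on the added coordinates only, and they integrate to \<open>1\<close>.\<close>
lemma nn_integral_subspace_lborel:
  fixes X :: "(real^'n) set"
  assumes X: "subspace X" and h [measurable]: "h \<in> borel_measurable borel"
  shows "(\<integral>\<^sup>+u. h u \<partial>subspace_lborel X) = (\<integral>\<^sup>+w. ennreal (gauss_weight X w) * h (proj X w) \<partial>lborel)"
proof -
  obtain B where B: "finite B" "B \<subseteq> X" "pairwise orthogonal B" "\<And>b. b \<in> B \<Longrightarrow> norm b = 1"
    "span B = X" "card B = dim X"
    "subspace_lborel X = distr (\<Pi>\<^sub>M b\<in>B. lborel) borel (\<lambda>c. \<Sum>b\<in>B. c b *\<^sub>R b)"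
    using subspace_lborel_orthonormal_basis[OF X] by blast
  have Xc: "subspace (X\<^sup>\<bottom>)" by (rule subspace_orthogonal_comp)
  obtain C where C: "finite C" "C \<subseteq> X\<^sup>\<bottom>" "pairwise orthogonal C" "\<And>b. b \<in> C \<Longrightarrow> norm b = 1"
    "span C = X\<^sup>\<bottom>" "card C = dim (X\<^sup>\<bottom>)"
    "subspace_lborel (X\<^sup>\<bottom>) = distr (\<Pi>\<^sub>M b\<in>C. lborel) borel (\<lambda>c. \<Sum>b\<in>C. c b *\<^sub>R b)"
    using subspace_lborel_orthonormal_basis[OF Xc] by blast
  have cardC: "card C = CARD('n) - dim X"
    using C dim_relative_complement[OF X subspace_UNIV] by simp
  have cross: "orthogonal b c" if "b \<in> B" "c \<in> C" for b c
    using that B(2) C(2) by (auto simp: orthogonal_comp_def)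
  have disj: "B \<inter> C = {}"
  proof safe
    fix b assume b: "b \<in> B" "b \<in> C"
    then have "orthogonal b b" using cross by blast
    then show "b \<in> {}" using B(4)[OF b(1)] by (simp add: orthogonal_self)
  qed
  have orth: "pairwise orthogonal (B \<union> C)"
    using B(3) C(3) cross orthogonal_commute unfolding pairwise_def by blast
  have "x \<in> span (B \<union> C)" for x
  proof -
    have "proj X x \<in> span (B \<union> C)" "x - proj X x \<in> span (B \<union> C)"
      using proj_in[OF X, of x] proj_in[OF Xc, of x] B(5) C(5) span_mono[of B "B \<union> C"] span_mono[of C "B \<union> C"]
      by (auto simp: proj_orthogonal_comp[OF X])
    then have "proj X x + (x - proj X x) \<in> span (B \<union> C)" by (rule span_add)
    then show ?thesis by simp
  qed
  then have "span (B \<union> C) = UNIV" by auto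
  then have lb: "lborel = distr (\<Pi>\<^sub>M b\<in>B \<union> C. lborel) borel (\<lambda>c. \<Sum>b\<in>B \<union> C. c b *\<^sub>R b)"
    using lborel_orthonormal_basis[OF orth] B(4) C(4) by (metis UnE)
  note [measurable] = gauss_weight_measurable[OF X] proj_measurable[OF X]
  define F where "F w = ennreal (gauss_weight X w) * h (proj X w)" for w
  have [measurable]: "F \<in> borel_measurable borel" unfolding F_def by measurable
  interpret product_sigma_finite "\<lambda>_. lborel :: real measure" ..
  have F: "F (\<Sum>b\<in>B \<union> C. merge B C (c, d) b *\<^sub>R b) =
      h (\<Sum>b\<in>B. c b *\<^sub>R b) * ennreal (1 / sqrt pi ^ card C) * ennreal (exp (- (\<Sum>i\<in>C. (d i)\<^sup>2)))" for c d
  proof -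
    define x where "x = (\<Sum>b\<in>B. c b *\<^sub>R b)"
    define y where "y = (\<Sum>b\<in>C. d b *\<^sub>R b)"
    have xX: "x \<in> X" unfolding x_def B(5)[symmetric] by (intro span_sum span_scale span_base)
    have yX: "y \<in> X\<^sup>\<bottom>" unfolding y_def C(5)[symmetric] by (intro span_sum span_scale span_base)
    have "(\<Sum>b\<in>B \<union> C. merge B C (c, d) b *\<^sub>R b) = x + y"
      using disj B(1) C(1) unfolding x_def y_def
      by (subst sum.union_disjoint) (auto simp: merge_def intro!: sum.cong arg_cong2[where f="(+)"])
    moreover have "proj X (x + y) = x"
      using xX yX by (simp add: proj_add X proj_ident proj_orthogonal_comp_eq_0)
    moreover have "(norm y)\<^sup>2 = (\<Sum>i\<in>C. (d i)\<^sup>2)"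
      unfolding y_def power2_norm_eq_inner using C by (subst orthonormal_sum_inner) (auto simp: power2_eq_square)
    ultimately show ?thesis
      by (simp add: F_def gauss_weight_def x_def[symmetric] cardC divide_inverse ennreal_mult mult_ac)
  qed
  have "(\<integral>\<^sup>+w. F w \<partial>lborel) = (\<integral>\<^sup>+c. F (\<Sum>b\<in>B \<union> C. c b *\<^sub>R b) \<partial>(\<Pi>\<^sub>M b\<in>B \<union> C. lborel))"
    by (subst lb) (simp add: nn_integral_distr)
  also have "\<dots> = (\<integral>\<^sup>+c. \<integral>\<^sup>+d. F (\<Sum>b\<in>B \<union> C. merge B C (c, d) b *\<^sub>R b) \<partial>(\<Pi>\<^sub>M b\<in>C. lborel) \<partial>(\<Pi>\<^sub>M b\<in>B. lborel))"
    using B(1) C(1) disj by (intro product_nn_integral_fold) auto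
  also have "\<dots> = (\<integral>\<^sup>+c. h (\<Sum>b\<in>B. c b *\<^sub>R b) \<partial>(\<Pi>\<^sub>M b\<in>B. lborel))"
  proof (rule nn_integral_cong)
    fix c
    have "(\<integral>\<^sup>+d. F (\<Sum>b\<in>B \<union> C. merge B C (c, d) b *\<^sub>R b) \<partial>(\<Pi>\<^sub>M b\<in>C. lborel)) =
        h (\<Sum>b\<in>B. c b *\<^sub>R b) * ennreal (1 / sqrt pi ^ card C) * ennreal (sqrt pi ^ card C)"
      unfolding F using C(1) by (simp add: nn_integral_cmult nn_integral_gaussian_coordinates)
    also have "\<dots> = h (\<Sum>b\<in>B. c b *\<^sub>R b)"
      by (simp add: mult.assoc ennreal_mult[symmetric])
    finally show "(\<integral>\<^sup>+d. F (\<Sum>b\<in>B \<union> C. merge B C (c, d) b *\<^sub>R b) \<partial>(\<Pi>\<^sub>M b\<in>C. lborel)) = h (\<Sum>b\<in>B. c b *\<^sub>R b)" .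
  qed
  also have "\<dots> = (\<integral>\<^sup>+u. h u \<partial>subspace_lborel X)"
    by (simp add: B(7) nn_integral_distr)
  finally show ?thesis by (simp add: F_def)
qed

lemma subspace_lborel_eq_distr:
  fixes X :: "(real^'n) set"
  assumes X: "subspace X"
  shows "subspace_lborel X = distr (density lborel (\<lambda>w. ennreal (gauss_weight X w))) borel (proj X)"
proof (rule measure_eqI)
  note [measurable] = gauss_weight_measurable[OF X] proj_measurable[OF X]
  fix A assume "A \<in> sets (subspace_lborel X)"
  then have [measurable]: "A \<in> sets borel" by simp
  have "emeasure (subspace_lborel X) A = (\<integral>\<^sup>+u. indicator A u \<partial>subspace_lborel X)" by simp
  also have "\<dots> = (\<integral>\<^sup>+w. ennreal (gauss_weight X w) * indicator A (proj X w) \<partial>lborel)"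
    by (rule nn_integral_subspace_lborel[OF X]) measurable
  also have "\<dots> = (\<integral>\<^sup>+u. indicator A u \<partial>distr (density lborel (\<lambda>w. ennreal (gauss_weight X w))) borel (proj X))"
    by (subst nn_integral_distr, measurable, subst nn_integral_density, auto)
  finally show "emeasure (subspace_lborel X) A =
      emeasure (distr (density lborel (\<lambda>w. ennreal (gauss_weight X w))) borel (proj X)) A" by simp
qed simp

lemma integral_subspace_lborel:
  fixes X :: "(real^'n) set" and h :: "real^'n \<Rightarrow> 'b::{banach,second_countable_topology}"
  assumes X: "subspace X" and h [measurable]: "h \<in> borel_measurable borel"
  shows "(LINT u|subspace_lborel X. h u) = (LINT w|lborel. gauss_weight X w *\<^sub>R h (proj X w))"
proof -
  note [measurable] = gauss_weight_measurable[OF X] proj_measurable[OF X]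
  show ?thesis unfolding subspace_lborel_eq_distr[OF X]
    by (simp add: integral_distr integral_density gauss_weight_nonneg)
qed

text \<open>The density of \<open>|u|^2\<close> under Lebesgue measure in dimension \<open>d\<close>: it is the derivative in \<open>t\<close> of the
volume of the ball of radius \<open>sqrt t\<close>.\<close>
definition radial_density :: "nat \<Rightarrow> real \<Rightarrow> real" where
  "radial_density d t = indicator {0<..} t * (pi powr (d / 2) / Gamma (d / 2)) * t powr (d / 2 - 1)"

lemma radial_density_nonneg: "0 \<le> radial_density d t"
  by (cases "d = 0") (auto simp: radial_density_def indicator_def intro!: mult_nonneg_nonneg divide_nonneg_nonneg less_imp_le[OF Gamma_real_pos])

lemma radial_density_measurable [measurable]: "radial_density d \<in> borel_measurable borel"
  unfolding radial_density_def by measurable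

text \<open>Polar coordinates. Both measures give the volume of a ball to the half-lines \<open>{..t}\<close>, and these
generate the Borel sets. For \<open>t \<le> 0\<close> the value \<open>0\<close> is obtained as a limit of the volumes of shrinking
balls, for which the dimension has to be positive.\<close>
lemma distr_norm_square_subspace_lborel:
  fixes X :: "(real^'n) set"
  assumes X: "subspace X" and d: "dim X > 0"
  shows "distr (subspace_lborel X) borel (\<lambda>u. (norm u)\<^sup>2) = density lborel (\<lambda>t. ennreal (radial_density (dim X) t))"
    (is "?M = ?N")
proof -
  define d where "d = dim X"
  have d0: "d > 0" using d by (simp add: d_def)
  obtain B where B: "finite B" "B \<subseteq> X" "pairwise orthogonal B" "\<And>b. b \<in> B \<Longrightarrow> norm b = 1"
    "span B = X" "card B = dim X"
    "subspace_lborel X = distr (\<Pi>\<^sub>M b\<in>B. lborel) borel (\<lambda>c. \<Sum>b\<in>B. c b *\<^sub>R b)"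
    using subspace_lborel_orthonormal_basis[OF X] by blast
  have norm_sum: "(norm (\<Sum>b\<in>B. c b *\<^sub>R b))\<^sup>2 = (\<Sum>b\<in>B. (c b)\<^sup>2)" for c
    unfolding power2_norm_eq_inner using B by (subst orthonormal_sum_inner) (auto simp: power2_eq_square)
  have M_pos: "emeasure ?M {..t} = ennreal (unit_ball_vol d * sqrt t ^ d)" if t: "t > 0" for t
  proof -
    have "emeasure ?M {..t} = emeasure (\<Pi>\<^sub>M b\<in>B. lborel)
        ({c. sqrt (\<Sum>i\<in>B. (c i)\<^sup>2) \<le> sqrt t} \<inter> space (\<Pi>\<^sub>M b\<in>B. lborel))"
      unfolding B(7)
      by (subst distr_distr) (auto simp: comp_def emeasure_distr norm_sum vimage_def Int_def conj_commute)
    also have "\<dots> = ennreal (unit_ball_vol d * sqrt t ^ d)"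
      using t B(1) by (subst emeasure_cball_aux) (auto simp: d_def B(6))
    finally show ?thesis .
  qed
  have N_pos: "emeasure ?N {..t} = ennreal (unit_ball_vol d * sqrt t ^ d)" if t: "t > 0" for t
  proof -
    define K where "K = pi powr (d / 2) / Gamma (d / 2)"
    have K: "K \<ge> 0" using assms(2) unfolding K_def by (auto intro!: divide_nonneg_nonneg less_imp_le[OF Gamma_real_pos] simp: d_def)
    have "((\<lambda>x. x powr (d / 2 - 1)) has_integral (t powr (d / 2 - 1 + 1) / (d / 2 - 1 + 1))) {0..t}"
      using assms(2) t by (intro has_integral_powr_from_0) (auto simp: d_def)
    from has_integral_mult_right[OF this, of K]
    have hi: "((\<lambda>x. K * x powr (d / 2 - 1)) has_integral (K * (t powr (d / 2) / (d / 2)))) {0..t}"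
      by simp
    have "emeasure ?N {..t} = (\<integral>\<^sup>+x. ennreal (radial_density d x) * indicator {..t} x \<partial>lborel)"
      by (simp add: emeasure_density d_def)
    also have "\<dots> = (\<integral>\<^sup>+x. ennreal (K * x powr (d / 2 - 1)) * indicator {0..t} x \<partial>lborel)"
      by (intro nn_integral_cong) (auto simp: radial_density_def K_def indicator_def)
    also have "\<dots> = ennreal (K * (t powr (d / 2) / (d / 2)))"
      using K by (intro nn_integral_has_integral_lebesgue'[OF _ hi]) auto
    also have "K * (t powr (d / 2) / (d / 2)) = unit_ball_vol d * sqrt t ^ d"
    proof -
      have "Gamma (d / 2 + 1) = d / 2 * Gamma (d / 2)"
        using assms(2) by (intro Gamma_plus1) (auto simp: d_def)
      moreover have "t powr (d / 2) = sqrt t ^ d"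
        using t by (simp add: powr_half_sqrt[symmetric] powr_realpow[symmetric] powr_powr)
      ultimately show ?thesis by (simp only: K_def unit_ball_vol_def) (simp add: field_simps)
    qed
    finally show ?thesis .
  qed
  have zero: "emeasure M {..t} = 0"
    if t: "t \<le> 0" and M: "sets M = sets borel"
      "\<And>s. s > 0 \<Longrightarrow> emeasure M {..s} = ennreal (unit_ball_vol d * sqrt s ^ d)" for t and M :: "real measure"
  proof -
    have "emeasure M {..t} \<le> ennreal (unit_ball_vol d * sqrt s ^ d)" if s: "s > 0" for s
    proof -
      have "emeasure M {..t} \<le> emeasure M {..s}" using s t M(1) by (intro emeasure_mono) auto
      then show ?thesis using M(2)[OF s] by simp
    qed
    moreover have "((\<lambda>s. ennreal (unit_ball_vol d * sqrt s ^ d)) \<longlongrightarrow> ennreal (unit_ball_vol d * sqrt 0 ^ d)) (at_right 0)"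
      by (intro tendsto_intros tendsto_ennrealI)
    ultimately have "emeasure M {..t} \<le> ennreal (unit_ball_vol d * sqrt 0 ^ d)"
      by (intro tendsto_lowerbound[where F="at_right (0::real)"])
         (auto simp: eventually_at_right_field intro!: exI[of _ 1])
    moreover have "(0 :: real) ^ d = 0" using d0 by (simp add: zero_power)
    ultimately show ?thesis by simp
  qed
  have M0: "emeasure ?M {..t} = 0" if "t \<le> 0" for t
    by (rule zero[OF that]) (simp_all only: M_pos sets_distr)
  have N0: "emeasure ?N {..t} = 0" if "t \<le> 0" for t
    by (rule zero[OF that]) (simp_all only: N_pos sets_density sets_lborel)
  show ?thesis
  proof (rule measure_eqI_generator_eq[where E="range atMost" and \<Omega>=UNIV and A="\<lambda>i. {..real i}"])
    show "Int_stable (range (atMost :: real \<Rightarrow> real set))"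
      unfolding Int_stable_def by (metis (no_types, lifting) Int_atMost imageE rangeI)
    show "sets ?M = sigma_sets UNIV (range atMost)" "sets ?N = sigma_sets UNIV (range atMost)"
      by (simp_all add: borel_eq_atMost)
    show "(\<Union>i. {..real i}) = UNIV" by (auto simp: real_arch_simple)
    show "emeasure ?M {..real i} \<noteq> \<infinity>" for i
      using M_pos[of "real i"] M0[of "real i"] by (cases "i = 0") auto
    fix S :: "real set" assume "S \<in> range atMost"
    then obtain t where "S = {..t}" by auto
    then show "emeasure ?M S = emeasure ?N S"
      using M_pos[of t] N_pos[of t] M0[of t] N0[of t] by (cases "t > 0") auto
  qed auto
qed

section \<open>Gamma and Beta integrals with complex exponents\<close>

text \<open>Turns the power into exponentials and real logarithms, for which measurability is known.\<close>
lemma of_real_powr_eq: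
  "complex_of_real t powr z = (if t = 0 then 0 else if t > 0 then exp (z * of_real (ln t))
     else exp (z * (of_real (ln (- t)) + \<i> * pi)))"
proof -
  have "Ln (of_real t) = of_real (ln (- t)) + \<i> * pi" if "t < 0"
    using that Ln_minus[of "of_real (- t)"] Ln_of_real[of "- t"] by simp
  then show ?thesis by (auto simp: powr_def Ln_of_real)
qed

lemma of_real_powr_measurable [measurable]:
  assumes [measurable]: "r \<in> borel_measurable M"
  shows "(\<lambda>x. complex_of_real (r x) powr z) \<in> borel_measurable M"
  unfolding of_real_powr_eq by measurable

lemma norm_of_real_powr: "0 \<le> t \<Longrightarrow> norm (complex_of_real t powr z) = t powr Re z"
  by (simp add: norm_powr_real_powr)

lemma of_real_mult_powr:
  "0 \<le> s \<Longrightarrow> 0 \<le> t \<Longrightarrow> complex_of_real (s * t) powr z = of_real s powr z * of_real t powr z"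
  by (simp add: powr_times_real)

lemma has_bochner_integral_Gamma:
  assumes "Re z > 0"
  shows "has_bochner_integral lborel
    (\<lambda>t. (indicator {0<..} t * exp (- t)) *\<^sub>R complex_of_real t powr (z - 1)) (Gamma z)"
proof -
  let ?f = "\<lambda>t. complex_of_real t powr (z - 1) / of_real (exp t)"
  have eq: "indicator {0<..} t *\<^sub>R ?f t = (indicator {0<..} t * exp (- t)) *\<^sub>R complex_of_real t powr (z - 1)" for t
    by (simp add: scaleR_conv_of_real exp_minus field_simps flip: exp_of_real)
  have meas: "(\<lambda>t. (indicator {0<..} t * exp (- t)) *\<^sub>R complex_of_real t powr (z - 1)) \<in> borel_measurable lborel"
    by measurable
  have abs: "set_integrable lebesgue {0<..} ?f"
    by (rule absolutely_integrable_Gamma_integral'[OF assms])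
  have "(LINT t:{0<..}|lebesgue. ?f t) = Gamma z"
    using set_lebesgue_integral_eq_integral(2)[OF abs] Gamma_integral_complex'[OF assms]
    by (simp add: integral_unique)
  with abs show ?thesis
    unfolding set_integrable_def set_lebesgue_integral_def eq has_bochner_integral_iff
    by (simp add: integrable_completion[OF meas] integral_completion[OF meas])
qed

lemma has_bochner_integral_Gamma_scaled:
  assumes z: "Re z > 0" and c: "c > 0"
  shows "has_bochner_integral lborel
    (\<lambda>t. (indicator {0<..} t * exp (- (c * t))) *\<^sub>R complex_of_real t powr (z - 1)) (Gamma z * of_real c powr (- z))"
proof -
  let ?f = "\<lambda>t. (indicator {0<..} t * exp (- t)) *\<^sub>R complex_of_real t powr (z - 1)"
  have "has_bochner_integral lborel (\<lambda>t. ?f (0 + c * t)) (Gamma z /\<^sub>R \<bar>c\<bar>)"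
    using has_bochner_integral_Gamma[OF z] c
    by (subst lborel_has_bochner_integral_real_affine_iff[symmetric]) auto
  then have "has_bochner_integral lborel (\<lambda>t. complex_of_real c powr (1 - z) * ?f (0 + c * t))
      (complex_of_real c powr (1 - z) * (Gamma z /\<^sub>R \<bar>c\<bar>))"
    by (rule has_bochner_integral_mult_right)
  moreover have "complex_of_real c powr (1 - z) * ?f (0 + c * t) =
      (indicator {0<..} t * exp (- (c * t))) *\<^sub>R complex_of_real t powr (z - 1)" for t
  proof (cases "t > 0")
    case True
    have "complex_of_real c powr (1 - z) * complex_of_real c powr (z - 1) = 1"
      using c by (simp flip: powr_add)
    then show ?thesis using True c of_real_mult_powr[of c t "z - 1"]
      by (simp add: scaleR_conv_of_real)
  next
    case False
    then have "\<not> 0 < c * t" using c by (simp add: zero_less_mult_iff)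
    then show ?thesis using False by simp
  qed
  moreover have "complex_of_real c powr (1 - z) * (Gamma z /\<^sub>R \<bar>c\<bar>) = Gamma z * of_real c powr (- z)"
  proof -
    have "complex_of_real c powr (1 - z) = of_real c * of_real c powr (- z)"
      using c powr_add[of "complex_of_real c" 1 "- z"] by simp
    then show ?thesis using c by (simp add: scaleR_conv_of_real field_simps)
  qed
  ultimately show ?thesis by simp
qed

lemma has_bochner_integral_Gamma_scaled_real:
  fixes a c :: real
  assumes a: "a > 0" and c: "c > 0"
  shows "has_bochner_integral lborel
    (\<lambda>t. indicator {0<..} t * exp (- (c * t)) * t powr (a - 1)) (Gamma a * c powr (- a))"
proof -
  have "has_bochner_integral lborel
    (\<lambda>t. Re ((indicator {0<..} t * exp (- (c * t))) *\<^sub>R complex_of_real t powr (of_real a - 1)))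
    (Re (Gamma (of_real a) * of_real c powr (- of_real a)))"
    using a c by (intro has_bochner_integral_Re has_bochner_integral_Gamma_scaled) auto
  moreover have "Re ((indicator {0<..} t * exp (- (c * t))) *\<^sub>R complex_of_real t powr (of_real a - 1)) =
      indicator {0<..} t * exp (- (c * t)) * t powr (a - 1)" for t
    using powr_of_real[of t "a - 1"] by (auto simp: indicator_def)
  moreover have "Re (Gamma (of_real a) * of_real c powr (- of_real a)) = Gamma a * c powr (- a)"
    using c powr_of_real[of c "- a"] by (simp add: Gamma_complex_of_real)
  ultimately show ?thesis by (simp only:)
qed

lemma Gamma_nonzero_of_Re_pos: "Re z > 0 \<Longrightarrow> Gamma (z :: complex) \<noteq> 0"
  by (auto simp: Gamma_eq_zero_iff elim!: nonpos_Ints_cases)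

text \<open>The Gamma integral writes \<open>Gamma z * (t + s)^(-z)\<close> as an integral over \<open>\<tau>\<close>. After exchange of the
two integrals, the one over \<open>t\<close> and then the one over \<open>\<tau>\<close> are Gamma integrals.\<close>
lemma has_bochner_integral_Beta_type2:
  fixes z :: complex and a s :: real
  assumes a: "a > 0" and z: "Re z > a" and s: "s > 0"
  shows "has_bochner_integral lborel
    (\<lambda>t. (indicator {0<..} t * t powr (a - 1)) *\<^sub>R complex_of_real (t + s) powr (- z))
    (Gamma (of_real a) * Gamma (z - of_real a) / Gamma z * of_real s powr (of_real a - z))"
proof -
  define G where "G = (\<lambda>(\<tau>, t). (indicator {0<..} \<tau> * indicator {0<..} t * t powr (a - 1) * exp (- (\<tau> * (t + s)))) *\<^sub>R
     complex_of_real \<tau> powr (z - 1))"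
  have [measurable]: "G \<in> borel_measurable (lborel \<Otimes>\<^sub>M lborel)"
    unfolding G_def by measurable
  have G1: "has_bochner_integral lborel (\<lambda>t. indicator {0<..} t * t powr (a - 1) * exp (- (\<tau> * (t + s))))
      (exp (- (s * \<tau>)) * Gamma a * \<tau> powr (- a))" if \<tau>: "\<tau> > 0" for \<tau>
  proof -
    have "exp (- (\<tau> * (t + s))) = exp (- (s * \<tau>)) * exp (- (\<tau> * t))" for t
      by (simp add: exp_add[symmetric] algebra_simps)
    then show ?thesis
      using has_bochner_integral_mult_right[OF has_bochner_integral_Gamma_scaled_real[OF a \<tau>], of "exp (- (s * \<tau>))"]
      by (simp add: mult_ac)
  qed
  have G1c: "has_bochner_integral lborel (\<lambda>t. G (\<tau>, t))
      ((indicator {0<..} \<tau> * exp (- (s * \<tau>)) * Gamma a) *\<^sub>R complex_of_real \<tau> powr (z - of_real a - 1))" for \<tau>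
  proof (cases "\<tau> > 0")
    case True
    have "complex_of_real \<tau> powr (z - of_real a - 1) = of_real (\<tau> powr (- a)) * complex_of_real \<tau> powr (z - 1)"
      using True powr_of_real[of \<tau> "- a"] powr_add[of "complex_of_real \<tau>" "- of_real a" "z - 1"] by (simp add: algebra_simps)
    then show ?thesis
      using has_bochner_integral_scaleR_left[OF G1[OF True], of "complex_of_real \<tau> powr (z - 1)"] True
      by (simp add: G_def scaleR_conv_of_real mult_ac)
  qed (simp add: G_def has_bochner_integral_zero)
  have G1n: "(LINT t|lborel. norm (G (\<tau>, t))) =
      Gamma a * (indicator {0<..} \<tau> * exp (- (s * \<tau>)) * \<tau> powr ((Re z - a) - 1))" for \<tau>
  proof (cases "\<tau> > 0")
    case True
    have "norm (G (\<tau>, t)) = (indicator {0<..} t * t powr (a - 1) * exp (- (\<tau> * (t + s)))) * \<tau> powr (Re z - 1)" for t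
      using True by (simp add: G_def norm_of_real_powr abs_mult)
    then have "(LINT t|lborel. norm (G (\<tau>, t))) = (exp (- (s * \<tau>)) * Gamma a * \<tau> powr (- a)) * \<tau> powr (Re z - 1)"
      using has_bochner_integral_integral_eq[OF G1[OF True]] by simp
    also have "\<dots> = exp (- (s * \<tau>)) * Gamma a * \<tau> powr ((Re z - a) - 1)"
      by (simp add: powr_add[symmetric] algebra_simps)
    finally show ?thesis using True by simp
  qed (simp add: G_def has_bochner_integral_zero)
  have int: "integrable (lborel \<Otimes>\<^sub>M lborel) G"
  proof (rule lborel_pair.Fubini_integrable)
    have "has_bochner_integral lborel (\<lambda>\<tau>. indicator {0<..} \<tau> * exp (- (s * \<tau>)) * \<tau> powr ((Re z - a) - 1))
       (Gamma (Re z - a) * s powr (- (Re z - a)))"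
      using z s by (intro has_bochner_integral_Gamma_scaled_real) auto
    then show "integrable lborel (\<lambda>\<tau>. LINT t|lborel. norm (G (\<tau>, t)))"
      unfolding G1n by (intro integrable_mult_right) (simp add: has_bochner_integral_iff)
    show "AE \<tau> in lborel. integrable lborel (\<lambda>t. G (\<tau>, t))"
      using G1c by (simp add: has_bochner_integral_iff)
  qed measurable
  have G2: "has_bochner_integral lborel (\<lambda>\<tau>. G (\<tau>, t))
      ((indicator {0<..} t * t powr (a - 1)) *\<^sub>R (Gamma z * complex_of_real (t + s) powr (- z)))" for t
  proof (cases "t > 0")
    case True
    have "has_bochner_integral lborel
        (\<lambda>\<tau>. (indicator {0<..} \<tau> * exp (- ((t + s) * \<tau>))) *\<^sub>R complex_of_real \<tau> powr (z - 1)) (Gamma z * of_real (t + s) powr (- z))"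
      using a z s True by (intro has_bochner_integral_Gamma_scaled) auto
    from has_bochner_integral_scaleR_right[OF this, of "t powr (a - 1)"] True show ?thesis
      by (simp add: G_def mult_ac)
  qed (simp add: G_def has_bochner_integral_zero)
  have int': "integrable (lborel \<Otimes>\<^sub>M lborel) (\<lambda>(\<tau>, t). G (\<tau>, t))" using int by simp
  have "integrable lborel (\<lambda>t. LINT \<tau>|lborel. G (\<tau>, t))"
    using lborel_pair.integrable_snd[OF int'] .
  moreover have "(LINT t|lborel. LINT \<tau>|lborel. G (\<tau>, t)) =
      of_real (Gamma a) * (Gamma (z - of_real a) * of_real s powr (- (z - of_real a)))"
  proof -
    have "(LINT t|lborel. LINT \<tau>|lborel. G (\<tau>, t)) = (LINT \<tau>|lborel. LINT t|lborel. G (\<tau>, t))"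
      using lborel_pair.Fubini_integral[OF int'] .
    also have "\<dots> = (LINT \<tau>|lborel. of_real (Gamma a) *
        ((indicator {0<..} \<tau> * exp (- (s * \<tau>))) *\<^sub>R complex_of_real \<tau> powr (z - of_real a - 1)))"
      by (simp add: has_bochner_integral_integral_eq[OF G1c] scaleR_conv_of_real mult_ac)
    also have "\<dots> = of_real (Gamma a) * (Gamma (z - of_real a) * of_real s powr (- (z - of_real a)))"
      using z s by (intro has_bochner_integral_integral_eq has_bochner_integral_mult_right has_bochner_integral_Gamma_scaled) auto
    finally show ?thesis .
  qed
  ultimately have "has_bochner_integral lborel (\<lambda>t. LINT \<tau>|lborel. G (\<tau>, t))
      (of_real (Gamma a) * (Gamma (z - of_real a) * of_real s powr (- (z - of_real a))))"
    by (simp add: has_bochner_integral_iff)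
  then have "has_bochner_integral lborel
      (\<lambda>t. (indicator {0<..} t * t powr (a - 1)) *\<^sub>R (Gamma z * complex_of_real (t + s) powr (- z)))
      (of_real (Gamma a) * (Gamma (z - of_real a) * of_real s powr (- (z - of_real a))))"
    by (simp only: has_bochner_integral_integral_eq[OF G2])
  from has_bochner_integral_mult_left[OF this, of "1 / Gamma z"]
  show ?thesis
    using Gamma_nonzero_of_Re_pos[of z] a z by (simp add: scaleR_conv_of_real Gamma_complex_of_real field_simps)
qed

section \<open>Integrals of powers of a distance over a subspace\<close>

lemma has_bochner_integral_subspace_lborel_iff:
  fixes X :: "(real^'n) set" and h :: "real^'n \<Rightarrow> 'b::{banach,second_countable_topology}"
  assumes X: "subspace X" and h [measurable]: "h \<in> borel_measurable borel"
  shows "has_bochner_integral (subspace_lborel X) h I \<longleftrightarrow>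
    has_bochner_integral lborel (\<lambda>w. gauss_weight X w *\<^sub>R h (proj X w)) I"
proof -
  note [measurable] = gauss_weight_measurable[OF X] proj_measurable[OF X]
  have "integrable (subspace_lborel X) h \<longleftrightarrow> integrable lborel (\<lambda>w. gauss_weight X w *\<^sub>R h (proj X w))"
    unfolding subspace_lborel_eq_distr[OF X]
    by (simp add: integrable_distr_eq integrable_density gauss_weight_nonneg)
  then show ?thesis
    using integral_subspace_lborel[OF X h] by (auto simp: has_bochner_integral_iff)
qed

text \<open>Translation by a vector of \<open>X\<close> does not change the component orthogonal to \<open>X\<close>, and so preserves
the Gaussian weight.\<close>
lemma subspace_lborel_translate:
  fixes X :: "(real^'n) set"
  assumes X: "subspace X" and a: "a \<in> X"
  shows "distr (subspace_lborel X) borel (\<lambda>u. u - a) = subspace_lborel X"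
proof (rule measure_eqI)
  note [measurable] = gauss_weight_measurable[OF X] proj_measurable[OF X]
  fix A assume "A \<in> sets (distr (subspace_lborel X) borel (\<lambda>u. u - a))"
  then have [measurable]: "A \<in> sets borel" by simp
  have g: "gauss_weight X (a + w) = gauss_weight X w" "proj X (a + w) = a + proj X w" for w
    using a by (simp_all add: gauss_weight_def proj_add X proj_ident)
  have "emeasure (distr (subspace_lborel X) borel (\<lambda>u. u - a)) A =
      (\<integral>\<^sup>+u. indicator A u \<partial>distr (subspace_lborel X) borel (\<lambda>u. u - a))" by simp
  also have "\<dots> = (\<integral>\<^sup>+u. indicator A (u - a) \<partial>subspace_lborel X)"
    by (rule nn_integral_distr) measurable
  also have "\<dots> = (\<integral>\<^sup>+w. ennreal (gauss_weight X w) * indicator A (proj X w - a) \<partial>lborel)"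
    by (rule nn_integral_subspace_lborel[OF X]) measurable
  also have "\<dots> = (\<integral>\<^sup>+w. ennreal (gauss_weight X (a + w)) * indicator A (proj X (a + w) - a) \<partial>lborel)"
    by (rule nn_integral_lborel_translate[symmetric]) measurable
  also have "\<dots> = (\<integral>\<^sup>+w. ennreal (gauss_weight X w) * indicator A (proj X w) \<partial>lborel)"
    by (simp add: g)
  also have "\<dots> = (\<integral>\<^sup>+u. indicator A u \<partial>subspace_lborel X)"
    by (rule nn_integral_subspace_lborel[OF X, symmetric]) measurable
  finally show "emeasure (distr (subspace_lborel X) borel (\<lambda>u. u - a)) A = emeasure (subspace_lborel X) A"
    by simp
qed simp

lemma has_bochner_integral_radial:
  fixes X :: "(real^'n) set" and H :: "real \<Rightarrow> 'b::{banach,second_countable_topology}"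
  assumes X: "subspace X" "dim X > 0" and a: "a \<in> X" and H [measurable]: "H \<in> borel_measurable borel"
    and I: "has_bochner_integral lborel (\<lambda>t. radial_density (dim X) t *\<^sub>R H t) I"
  shows "has_bochner_integral (subspace_lborel X) (\<lambda>u. H ((norm (u - a))\<^sup>2)) I"
proof -
  have eq: "distr (subspace_lborel X) borel (\<lambda>u. (norm (u - a))\<^sup>2) = density lborel (\<lambda>t. ennreal (radial_density (dim X) t))"
    unfolding distr_norm_square_subspace_lborel[OF X, symmetric]
    by (subst (2) subspace_lborel_translate[OF X(1) a, symmetric]) (simp add: distr_distr comp_def)
  have "has_bochner_integral (density lborel (\<lambda>t. ennreal (radial_density (dim X) t))) H I"
    using I by (simp add: has_bochner_integral_iff integrable_density integral_density radial_density_nonneg)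
  then show ?thesis unfolding eq[symmetric]
    by (simp add: has_bochner_integral_iff integrable_distr_eq integral_distr)
qed

lemma nn_integral_radial:
  fixes X :: "(real^'n) set" and H :: "real \<Rightarrow> ennreal"
  assumes X: "subspace X" "dim X > 0" and a: "a \<in> X" and H [measurable]: "H \<in> borel_measurable borel"
  shows "(\<integral>\<^sup>+u. H ((norm (u - a))\<^sup>2) \<partial>subspace_lborel X) = (\<integral>\<^sup>+t. ennreal (radial_density (dim X) t) * H t \<partial>lborel)"
proof -
  have eq: "distr (subspace_lborel X) borel (\<lambda>u. (norm (u - a))\<^sup>2) = density lborel (\<lambda>t. ennreal (radial_density (dim X) t))"
    unfolding distr_norm_square_subspace_lborel[OF X, symmetric]
    by (subst (2) subspace_lborel_translate[OF X(1) a, symmetric]) (simp add: distr_distr comp_def)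
  have "(\<integral>\<^sup>+u. H ((norm (u - a))\<^sup>2) \<partial>subspace_lborel X) = (\<integral>\<^sup>+t. H t \<partial>distr (subspace_lborel X) borel (\<lambda>u. (norm (u - a))\<^sup>2))"
    by (simp add: nn_integral_distr)
  then show ?thesis unfolding eq by (simp add: nn_integral_density)
qed

lemma of_real_sqrt_powr:
  assumes "0 \<le> x" shows "complex_of_real (sqrt x) powr b = of_real x powr (b / 2)"
proof -
  have "complex_of_real x powr (b / 2) = of_real (sqrt x * sqrt x) powr (b / 2)" using assms by simp
  also have "\<dots> = of_real (sqrt x) powr (b / 2 + b / 2)"
    using assms by (simp only: of_real_mult_powr real_sqrt_ge_zero powr_add)
  finally show ?thesis by simp
qed

text \<open>Real exponents are a special case of complex ones. This passes from the evaluation of a complex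
integral to that of the integral of the absolute value.\<close>
lemma nn_integral_of_real_powr:
  assumes I: "has_bochner_integral M (\<lambda>x. w x *\<^sub>R complex_of_real (r x) powr of_real b) C"
    and nonneg: "\<And>x. 0 \<le> w x" "\<And>x. 0 \<le> r x"
  shows "(\<integral>\<^sup>+x. ennreal (w x * r x powr b) \<partial>M) = ennreal (Re C)"
proof -
  have "has_bochner_integral M (\<lambda>x. Re (w x *\<^sub>R complex_of_real (r x) powr of_real b)) (Re C)"
    by (rule has_bochner_integral_Re[OF I])
  moreover have "Re (w x *\<^sub>R complex_of_real (r x) powr of_real b) = w x * r x powr b" for x
    by (simp add: powr_of_real nonneg)
  ultimately have "has_bochner_integral M (\<lambda>x. w x * r x powr b) (Re C)" by (simp only:)
  then show ?thesis
    using nonneg by (subst nn_integral_eq_integral) (auto simp: has_bochner_integral_iff)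
qed

text \<open>For \<open>l > 0\<close> and \<open>Re b + l < 0\<close> this is the integral of \<open>(|u|^2 + 1)^(b/2)\<close> over an
\<open>l\<close>-dimensional space.\<close>
definition fibre_const :: "nat \<Rightarrow> complex \<Rightarrow> complex" where
  "fibre_const l b = of_real (pi powr (l / 2)) * Gamma (- (b + of_nat l) / 2) / Gamma (- b / 2)"

text \<open>In polar coordinates around \<open>a\<close> this is the Beta integral above, with \<open>l/2\<close>, \<open>- b/2\<close> and \<open>s^2\<close> for
\<open>a\<close>, \<open>z\<close> and \<open>s\<close>.\<close>
lemma has_bochner_integral_fibre:
  fixes X :: "(real^'n) set" and b :: complex
  assumes X: "subspace X" "dim X = l" "l > 0" and a: "a \<in> X" and s: "s > 0" and b: "Re b + l < 0"
  shows "has_bochner_integral (subspace_lborel X)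
    (\<lambda>u. complex_of_real (sqrt ((norm (u - a))\<^sup>2 + s\<^sup>2)) powr b) (fibre_const l b * of_real s powr (b + of_nat l))"
proof -
  define H where "H t = complex_of_real (sqrt (t + s\<^sup>2)) powr b" for t
  define K where "K = pi powr (l / 2) / Gamma (l / 2)"
  have "has_bochner_integral lborel
    (\<lambda>t. (indicator {0<..} t * t powr (l / 2 - 1)) *\<^sub>R complex_of_real (t + s\<^sup>2) powr (- (- b / 2)))
    (Gamma (of_real (l / 2)) * Gamma (- b / 2 - of_real (l / 2)) / Gamma (- b / 2) * of_real (s\<^sup>2) powr (of_real (l / 2) - - b / 2))"
    using X(3) b s by (intro has_bochner_integral_Beta_type2) auto
  note I = has_bochner_integral_scaleR_right[OF this, of K]
  have f: "K *\<^sub>R ((indicator {0<..} t * t powr (l / 2 - 1)) *\<^sub>R complex_of_real (t + s\<^sup>2) powr (- (- b / 2))) =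
      radial_density (dim X) t *\<^sub>R H t" for t
    using s by (auto simp: radial_density_def H_def K_def X(2) of_real_sqrt_powr indicator_def)
  from I have "has_bochner_integral lborel (\<lambda>t. radial_density (dim X) t *\<^sub>R H t)
    (K *\<^sub>R (Gamma (of_real (l / 2)) * Gamma (- b / 2 - of_real (l / 2)) / Gamma (- b / 2) * of_real (s\<^sup>2) powr (of_real (l / 2) - - b / 2)))"
    by (simp only: f)
  moreover have "complex_of_real (s\<^sup>2) powr (of_real (l / 2) - - b / 2) = of_real s powr (b + of_nat l)"
    using of_real_sqrt_powr[of "s\<^sup>2" "b + of_nat l"] s by (simp add: field_simps)
  moreover have "0 < Gamma (l / 2)" using X(3) by (intro Gamma_real_pos) simp
  then have "complex_of_real K * Gamma (of_real (l / 2)) = of_real (pi powr (l / 2))"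
    by (simp only: K_def Gamma_complex_of_real) simp
  moreover have "Gamma (- (b / 2) - of_nat l / 2) = Gamma ((- b - of_nat l) / 2)"
    by (simp add: diff_divide_distrib)
  ultimately have "has_bochner_integral lborel (\<lambda>t. radial_density (dim X) t *\<^sub>R H t)
     (fibre_const l b * of_real s powr (b + of_nat l))"
    by (simp add: fibre_const_def scaleR_conv_of_real mult.assoc[symmetric] del: of_real_mult)
  then show ?thesis
    using has_bochner_integral_radial[OF X(1) _ a, of H] X unfolding H_def by simp
qed

lemma fibre_const_of_real:
  "fibre_const l (of_real b) = of_real (pi powr (l / 2) * Gamma (- (b + l) / 2) / Gamma (- b / 2))"
proof -
  have "Gamma (- (complex_of_real b + of_nat l) / 2) = of_real (Gamma (- (b + l) / 2))"
    "Gamma (- complex_of_real b / 2) = of_real (Gamma (- b / 2))"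
    by (simp_all flip: Gamma_complex_of_real)
  then show ?thesis by (simp add: fibre_const_def)
qed

lemma nn_integral_fibre:
  fixes X :: "(real^'n) set" and b :: real
  assumes X: "subspace X" "dim X = l" "l > 0" and a: "a \<in> X" and s: "s > 0" and b: "b + l < 0"
  shows "(\<integral>\<^sup>+u. ennreal (sqrt ((norm (u - a))\<^sup>2 + s\<^sup>2) powr b) \<partial>subspace_lborel X) =
    ennreal (Re (fibre_const l (of_real b)) * s powr (b + l))"
proof -
  have "has_bochner_integral (subspace_lborel X)
    (\<lambda>u. 1 *\<^sub>R complex_of_real (sqrt ((norm (u - a))\<^sup>2 + s\<^sup>2)) powr of_real b)
      (fibre_const l (of_real b) * of_real s powr (of_real b + of_nat l))"
    using has_bochner_integral_fibre[OF X a s, of "of_real b"] b by simp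
  from nn_integral_of_real_powr[OF this]
  have "(\<integral>\<^sup>+u. ennreal (sqrt ((norm (u - a))\<^sup>2 + s\<^sup>2) powr b) \<partial>subspace_lborel X) =
    ennreal (Re (fibre_const l (of_real b) * of_real s powr (of_real b + of_nat l)))" by simp
  moreover have "complex_of_real s powr (of_real b + of_nat l) = of_real (s powr (b + l))"
    using powr_of_real[of s "b + l"] s by simp
  ultimately show ?thesis by (simp add: fibre_const_of_real)
qed

lemma fibre_const_pos: "(b :: real) + real l < 0 \<Longrightarrow> 0 < Re (fibre_const l (of_real b))"
  by (simp add: fibre_const_of_real Gamma_real_pos)

lemma nn_integral_inverse_at_top:
  assumes T: "T > 0"
  shows "(\<integral>\<^sup>+t. ennreal (1 / t) * indicator {T..} t \<partial>(lborel :: real measure)) = \<infinity>"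
proof -
  have "of_nat n \<le> (\<integral>\<^sup>+t. ennreal (1 / t) * indicator {T..} t \<partial>(lborel :: real measure))" for n
  proof -
    have "(\<integral>\<^sup>+t. ennreal (1 / t) * indicator {T..T * exp n} t \<partial>lborel) = ennreal (ln (T * exp n) - ln T)"
      using T by (intro nn_integral_FTC_Icc) (auto intro!: derivative_eq_intros)
    also have "ln (T * exp n) - ln T = n" using T by (simp add: ln_mult)
    finally have "(\<integral>\<^sup>+t. ennreal (1 / t) * indicator {T..T * exp n} t \<partial>lborel) = of_nat n"
      by (simp add: ennreal_of_nat_eq_real_of_nat)
    moreover have "(\<integral>\<^sup>+t. ennreal (1 / t) * indicator {T..T * exp n} t \<partial>lborel) \<le>
        (\<integral>\<^sup>+t. ennreal (1 / t) * indicator {T..} t \<partial>(lborel :: real measure))"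
      by (intro nn_integral_mono) (auto simp: indicator_def)
    ultimately show ?thesis by simp
  qed
  note le = this
  show ?thesis
  proof (rule ccontr)
    assume "\<not> ?thesis"
    then obtain n where "(\<integral>\<^sup>+t. ennreal (1 / t) * indicator {T..} t \<partial>(lborel :: real measure)) < of_nat n"
      using ennreal_Ex_less_of_nat by (auto simp: less_top)
    with le[of n] show False by simp
  qed
qed

text \<open>For large \<open>t = |u - a|^2\<close> the radial integrand is at least a positive multiple of \<open>1 / t\<close>.\<close>
lemma nn_integral_fibre_infinite:
  fixes X :: "(real^'n) set" and b s :: real
  assumes X: "subspace X" "dim X = l" "l > 0" and a: "a \<in> X" and b: "b + l \<ge> 0"
  shows "(\<integral>\<^sup>+u. ennreal (sqrt ((norm (u - a))\<^sup>2 + s\<^sup>2) powr b) \<partial>subspace_lborel X) = \<infinity>"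
proof -
  define K where "K = pi powr (l / 2) / Gamma (l / 2) * min 1 (2 powr (b / 2))"
  have K: "K > 0" using X(3) Gamma_real_pos[of "l / 2"] by (simp add: K_def)
  \<comment> \<open>Beyond \<open>T\<close> both \<open>t \<le> t + s^2 \<le> 2 t\<close> and \<open>t \<ge> 1\<close> hold; the minimum in \<open>K\<close> covers both signs of \<open>b\<close>.\<close>
  define T where "T = max 1 (s\<^sup>2)"
  have le: "ennreal K * (ennreal (1 / t) * indicator {T..} t) \<le>
      ennreal (radial_density (dim X) t) * ennreal (sqrt (t + s\<^sup>2) powr b)" for t
  proof (cases "t \<ge> T")
    case True
    then have t: "t \<ge> 1" "s\<^sup>2 \<le> t" by (auto simp: T_def)
    have "1 / t = t powr (- 1)" using t by (simp add: powr_minus_divide)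
    also have "\<dots> \<le> t powr (l / 2 - 1 + b / 2)" using t b by (intro powr_mono) auto
    finally have 1: "1 / t \<le> t powr (l / 2 - 1) * t powr (b / 2)" by (simp add: powr_add)
    have 2: "min 1 (2 powr (b / 2)) * t powr (b / 2) \<le> (t + s\<^sup>2) powr (b / 2)"
    proof (cases "b \<ge> 0")
      case True
      have "min 1 (2 powr (b / 2)) * t powr (b / 2) \<le> 1 * t powr (b / 2)"
        by (intro mult_right_mono) auto
      also have "\<dots> \<le> (t + s\<^sup>2) powr (b / 2)" using t True by (simp add: powr_mono2)
      finally show ?thesis .
    next
      case False
      have "min 1 (2 powr (b / 2)) * t powr (b / 2) \<le> 2 powr (b / 2) * t powr (b / 2)"
        by (intro mult_right_mono) auto
      also have "\<dots> = (2 * t) powr (b / 2)" using t by (simp add: powr_mult)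
      also have "\<dots> \<le> (t + s\<^sup>2) powr (b / 2)" using t False by (intro powr_mono2') (auto simp: add_pos_nonneg)
      finally show ?thesis .
    qed
    have 3: "sqrt (t + s\<^sup>2) powr b = (t + s\<^sup>2) powr (b / 2)"
      using t by (simp add: powr_half_sqrt[symmetric] powr_powr)
    define C where "C = pi powr (l / 2) / Gamma (l / 2)"
    have C: "C \<ge> 0" using X(3) Gamma_real_pos[of "l / 2"] by (simp add: C_def)
    have "K * (1 / t) \<le> K * (t powr (l / 2 - 1) * t powr (b / 2))"
      using 1 K by (intro mult_left_mono) auto
    also have "\<dots> = C * t powr (l / 2 - 1) * (min 1 (2 powr (b / 2)) * t powr (b / 2))"
      by (simp add: K_def C_def)
    also have "\<dots> \<le> C * t powr (l / 2 - 1) * (t + s\<^sup>2) powr (b / 2)"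
      using C 2 by (intro mult_left_mono) auto
    also have "\<dots> = radial_density (dim X) t * sqrt (t + s\<^sup>2) powr b"
      using t by (simp add: 3 radial_density_def C_def X(2))
    finally show ?thesis
      using True K t by (simp add: ennreal_mult[symmetric] radial_density_nonneg)
  qed simp
  have "\<infinity> = ennreal K * (\<integral>\<^sup>+t. ennreal (1 / t) * indicator {T..} t \<partial>lborel)"
    using K by (subst nn_integral_inverse_at_top) (auto simp: T_def ennreal_mult_top)
  also have "\<dots> \<le> (\<integral>\<^sup>+t. ennreal (radial_density (dim X) t) * ennreal (sqrt (t + s\<^sup>2) powr b) \<partial>lborel)"
    using le by (subst nn_integral_cmult[symmetric]) (auto intro!: nn_integral_mono)
  also have "\<dots> = (\<integral>\<^sup>+u. ennreal (sqrt ((norm (u - a))\<^sup>2 + s\<^sup>2) powr b) \<partial>subspace_lborel X)"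
    using X by (intro nn_integral_radial[OF X(1) _ a, symmetric]) auto
  finally show ?thesis by (simp add: top_unique)
qed

text \<open>For \<open>d > 0\<close> and \<open>Re b + d > 0\<close> this is the integral of \<open>exp (-|x|^2) * |proj W x|^b\<close> over the
\<open>n\<close>-dimensional space, where \<open>W\<close> has dimension \<open>d\<close>.\<close>
definition gauss_moment :: "nat \<Rightarrow> nat \<Rightarrow> complex \<Rightarrow> complex" where
  "gauss_moment n d b = of_real (sqrt pi ^ n) * Gamma ((of_nat d + b) / 2) / Gamma (of_nat d / 2)"

lemma has_bochner_integral_gauss_moment:
  fixes W :: "(real^'n) set"
  assumes W: "subspace W" "dim W = d" "d > 0" and b: "Re b + d > 0"
  shows "has_bochner_integral lborel (\<lambda>x. exp (- (norm x)\<^sup>2) *\<^sub>R complex_of_real (norm (proj W x)) powr b)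
    (gauss_moment CARD('n) d b)"
proof -
  define H where "H t = exp (- t) *\<^sub>R complex_of_real (sqrt t) powr b" for t
  define K where "K = pi powr (d / 2) / Gamma (d / 2)"
  note [measurable] = proj_measurable[OF W(1)]
  have "has_bochner_integral lborel (\<lambda>t. (indicator {0<..} t * exp (- t)) *\<^sub>R complex_of_real t powr ((of_nat d + b) / 2 - 1))
    (Gamma ((of_nat d + b) / 2))"
    using b by (intro has_bochner_integral_Gamma) auto
  note I = has_bochner_integral_scaleR_right[OF this, of K]
  have "complex_of_real t powr ((of_nat d + b) / 2 - 1) = of_real (t powr (d / 2 - 1)) * complex_of_real (sqrt t) powr b"
    if "t > 0" for t
  proof -
    have "complex_of_real t powr ((of_nat d + b) / 2 - 1) = complex_of_real t powr of_real (d / 2 - 1) * complex_of_real t powr (b / 2)"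
      using that by (simp add: powr_add[symmetric] field_simps)
    then show ?thesis using that by (simp only: powr_of_real of_real_sqrt_powr less_imp_le)
  qed
  then have f: "K *\<^sub>R ((indicator {0<..} t * exp (- t)) *\<^sub>R complex_of_real t powr ((of_nat d + b) / 2 - 1)) =
      radial_density (dim W) t *\<^sub>R H t" for t
    by (auto simp: radial_density_def H_def K_def W(2) indicator_def scaleR_conv_of_real mult_ac)
  from I have "has_bochner_integral lborel (\<lambda>t. radial_density (dim W) t *\<^sub>R H t) (K *\<^sub>R Gamma ((of_nat d + b) / 2))"
    by (simp only: f)
  then have "has_bochner_integral (subspace_lborel W) (\<lambda>u. H ((norm u)\<^sup>2)) (K *\<^sub>R Gamma ((of_nat d + b) / 2))"
    using has_bochner_integral_radial[OF W(1) _ subspace_0[OF W(1)], of H] W unfolding H_def by simp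
  then have "has_bochner_integral lborel (\<lambda>x. gauss_weight W x *\<^sub>R H ((norm (proj W x))\<^sup>2)) (K *\<^sub>R Gamma ((of_nat d + b) / 2))"
    using has_bochner_integral_subspace_lborel_iff[OF W(1), of "\<lambda>u. H ((norm u)\<^sup>2)"] unfolding H_def by simp
  note I = has_bochner_integral_scaleR_right[OF this, of "sqrt pi ^ (CARD('n) - d)"]
  have f: "sqrt pi ^ (CARD('n) - d) *\<^sub>R (gauss_weight W x *\<^sub>R H ((norm (proj W x))\<^sup>2)) =
      exp (- (norm x)\<^sup>2) *\<^sub>R complex_of_real (norm (proj W x)) powr b" for x
  proof -
    have "exp (- (norm x)\<^sup>2) = exp (- (norm (x - proj W x))\<^sup>2) * exp (- (norm (proj W x))\<^sup>2)"
      using norm_proj_pythagoras[OF W(1), of x] by (simp flip: exp_add)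
    then show ?thesis by (simp add: gauss_weight_def H_def W(2))
  qed
  have "d \<le> CARD('n)" using dim_subset_UNIV[of W] W(2) by simp
  then have "sqrt pi ^ CARD('n) = sqrt pi ^ (CARD('n) - d) * sqrt pi ^ d" by (simp flip: power_add)
  moreover have "pi powr (d / 2) = sqrt pi ^ d" by (simp add: powr_half_sqrt[symmetric] powr_realpow[symmetric] powr_powr)
  moreover have "Gamma (of_nat d / 2 :: complex) = of_real (Gamma (d / 2))" by (simp flip: Gamma_complex_of_real)
  ultimately have "sqrt pi ^ (CARD('n) - d) *\<^sub>R (K *\<^sub>R Gamma ((of_nat d + b) / 2)) = gauss_moment CARD('n) d b"
    by (simp add: gauss_moment_def K_def scaleR_conv_of_real)
  then show ?thesis using I by (simp only: f)
qed

section \<open>Averages over a Grassmannian\<close>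

lemma space_grassmannian_borel [simp]: "space (grassmannian_borel X m) = grassmannian X m"
  by (simp add: grassmannian_borel_def)

lemma matrix_proj: "subspace (V :: (real^'n) set) \<Longrightarrow> matrix (proj V) *v x = proj V x"
  by (simp add: matrix_vector_mul(2) linear_proj)

lemma matrix_vector_mult_measurable [measurable]:
  fixes A :: "'a \<Rightarrow> real^'n^'m"
  assumes "A \<in> borel_measurable M" "x \<in> borel_measurable M"
  shows "(\<lambda>a. A a *v x a) \<in> borel_measurable M"
proof -
  have "continuous_on UNIV (\<lambda>p :: (real^'n^'m) \<times> (real^'n). fst p *v snd p)"
    unfolding matrix_vector_mult_def by (intro continuous_intros)
  from borel_measurable_continuous_on[OF this, of "\<lambda>a. (A a, x a)" M] assms show ?thesis by simp
qed

text \<open>The Borel structure is that of the projection matrices, so evaluating a projection is measurable in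
the subspace and the vector jointly.\<close>
lemma proj_grassmannian_measurable [measurable (raw)]:
  fixes x :: "'a \<Rightarrow> real^'n"
  assumes V: "V \<in> N \<rightarrow>\<^sub>M grassmannian_borel X m" and [measurable]: "x \<in> borel_measurable N"
  shows "(\<lambda>a. proj (V a) (x a)) \<in> borel_measurable N"
proof -
  have "(\<lambda>V. matrix (proj V)) \<in> borel_measurable (grassmannian_borel X m)"
    unfolding grassmannian_borel_def by (rule measurable_vimage_algebra1) simp
  from measurable_compose[OF V this]
  have [measurable]: "(\<lambda>a. matrix (proj (V a))) \<in> borel_measurable N" .
  have "(\<lambda>a. matrix (proj (V a)) *v x a) \<in> borel_measurable N" by measurable
  moreover have "subspace (V a)" if "a \<in> space N" for a
    using measurable_space[OF V that] by (simp add: grassmannian_def)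
  ultimately show ?thesis by (subst measurable_cong[of _ _ "\<lambda>a. matrix (proj (V a)) *v x a"]) (simp_all add: matrix_proj)
qed

text \<open>The columns of the projection matrix are the projections of the standard basis vectors.\<close>
lemma measurable_into_grassmannianI:
  fixes V :: "'a \<Rightarrow> (real^'n) set"
  assumes "\<And>a. a \<in> space N \<Longrightarrow> V a \<in> grassmannian X m"
    and proj: "\<And>x. (\<lambda>a. proj (V a) x) \<in> borel_measurable N"
  shows "V \<in> N \<rightarrow>\<^sub>M grassmannian_borel X m"
  unfolding grassmannian_borel_def
proof (rule measurable_vimage_algebra2)
  show "V \<in> space N \<rightarrow> grassmannian X m" using assms by auto
  have "(\<lambda>a. matrix (proj (V a)) \<bullet> axis i (axis j 1)) \<in> borel_measurable N" for i j
    using borel_measurable_inner[OF proj[of "axis j 1"], of "\<lambda>_. axis i 1"]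
    by (simp add: matrix_def inner_axis)
  then show "(\<lambda>a. matrix (proj (V a))) \<in> borel_measurable N"
    by (subst borel_measurable_euclidean_space) (auto simp: Basis_vec_def)
qed

lemma orthogonal_image_measurable:
  fixes T :: "real^'n \<Rightarrow> real^'n"
  assumes T: "orthogonal_transformation T" and TX: "T ` X = X"
  shows "(\<lambda>V. T ` V) \<in> grassmannian_borel X m \<rightarrow>\<^sub>M grassmannian_borel X m"
proof (rule measurable_into_grassmannianI)
  have lin: "linear T" by (rule orthogonal_transformation_linear[OF T])
  have inj: "inj T" by (rule orthogonal_transformation_inj[OF T])
  fix V :: "(real^'n) set" assume "V \<in> space (grassmannian_borel X m)"
  then show "T ` V \<in> grassmannian X m"
    using TX lin inj by (auto simp: grassmannian_def linear_subspace_image dim_image_eq inj_on_subset[OF inj])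
next
  fix x
  obtain y where y: "T y = x" using orthogonal_transformation_surj[OF T] by (metis surjD)
  have [measurable]: "T \<in> borel_measurable borel"
    using orthogonal_transformation_linear[OF T]
    by (intro borel_measurable_continuous_onI linear_continuous_on) (simp add: linear_linear)
  have "(\<lambda>V. T (proj V y)) \<in> borel_measurable (grassmannian_borel X m)" by measurable
  moreover have "proj (T ` V) x = T (proj V y)" if "V \<in> space (grassmannian_borel X m)" for V
    using that proj_orthogonal_image[OF T, of V y] y by (simp add: grassmannian_def)
  ultimately show "(\<lambda>V. proj (T ` V) x) \<in> borel_measurable (grassmannian_borel X m)"
    by (subst measurable_cong) auto
qed

text \<open>For an invariant probability measure on \<open>G_q(E)\<close>, the aim is the average over \<open>Q\<close> of the power \<open>b\<close>
of the distance from a point of \<open>E\<close> to \<open>Q\<close>.\<close>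
locale grassmann_average =
  fixes E :: "(real^'n) set" and q N :: nat and M :: "(real^'n) set measure"
  assumes E: "subspace E" "dim E = N" and qN: "q < N" and inv: "invariant_grassmann_measure E q M"
begin

lemma sets_M [measurable_cong, simp]: "sets M = sets (grassmannian_borel E q)"
  using inv by (simp add: invariant_grassmann_measure_def)

lemma space_M: "space M = grassmannian E q"
  using sets_eq_imp_space_eq[OF sets_M] by simp

sublocale prob_space M
  using inv by (simp add: invariant_grassmann_measure_def)

sublocale pair_sigma_finite lborel M ..

lemma in_M: "Q \<in> space M \<Longrightarrow> subspace Q \<and> Q \<subseteq> E \<and> dim Q = q"
  by (simp add: space_M grassmannian_def)

text \<open>The only use of invariance: an orthogonal map of \<open>E\<close> that takes \<open>y\<close> to \<open>y'\<close> preserves the measure and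
carries the distance of \<open>y\<close> from \<open>Q\<close> to that of \<open>y'\<close> from the image of \<open>Q\<close>.\<close>
lemma law_of_distance_invariant:
  assumes y: "y \<in> E" "y' \<in> E" "norm y = norm y'"
  shows "distr M borel (\<lambda>Q. norm (y - proj Q y)) = distr M borel (\<lambda>Q. norm (y' - proj Q y'))"
proof -
  obtain T where T: "orthogonal_transformation T" "T ` E = E" "T y = y'"
    using exists_reflection_in_subspace[OF E(1) y] by blast
  have lin: "linear T" by (rule orthogonal_transformation_linear[OF T(1)])
  have meas: "(\<lambda>V. T ` V) \<in> M \<rightarrow>\<^sub>M M"
    using orthogonal_image_measurable[OF T(1,2), of q] by (simp add: measurable_cong_sets[OF sets_M sets_M])
  have "distr M borel (\<lambda>Q. norm (y' - proj Q y')) = distr (distr M M (\<lambda>V. T ` V)) borel (\<lambda>Q. norm (y' - proj Q y'))"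
    using inv T by (simp add: invariant_grassmann_measure_def)
  also have "\<dots> = distr M borel (\<lambda>Q. norm (y' - proj (T ` Q) y'))"
    using meas by (subst distr_distr) (auto simp: comp_def)
  also have "\<dots> = distr M borel (\<lambda>Q. norm (y - proj Q y))"
  proof (intro distr_cong refl)
    fix Q assume "Q \<in> space M"
    then have "proj (T ` Q) y' = T (proj Q y)" using proj_orthogonal_image[OF T(1), of Q y] T(3) in_M by simp
    then have "y' - proj (T ` Q) y' = T (y - proj Q y)" using T(3) by (simp add: linear_diff[OF lin])
    then show "norm (y' - proj (T ` Q) y') = norm (y - proj Q y)"
      using orthogonal_transformation_norm[OF T(1)] by simp
  qed
  finally show ?thesis by simp
qed

lemma law_of_distance_scaling:
  assumes y: "y \<in> E" and e: "e \<in> E" "norm e = 1"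
  shows "distr M borel (\<lambda>Q. norm (y - proj Q y)) = distr M borel (\<lambda>Q. norm y * norm (e - proj Q e))"
proof -
  have "distr M borel (\<lambda>Q. norm (y - proj Q y)) =
      distr M borel (\<lambda>Q. norm (norm y *\<^sub>R e - proj Q (norm y *\<^sub>R e)))"
    using y e E(1) by (intro law_of_distance_invariant) (auto simp: subspace_scale)
  also have "\<dots> = distr M borel (\<lambda>Q. norm y * norm (e - proj Q e))"
  proof (intro distr_cong refl)
    fix Q assume "Q \<in> space M"
    then show "norm (norm y *\<^sub>R e - proj Q (norm y *\<^sub>R e)) = norm y * norm (e - proj Q e)"
      using in_M by (simp add: proj_scaleR flip: scaleR_diff_right)
  qed
  finally show ?thesis .
qed

lemma exists_unit: obtains e where "e \<in> E" "norm e = 1"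
proof -
  obtain B where "B \<subseteq> E" "\<And>x. x \<in> B \<Longrightarrow> norm x = 1" "card B = dim E"
    using orthonormal_basis_subspace[OF E(1)] by metis
  moreover have "card B \<noteq> 0" using calculation qN E(2) by simp
  then have "B \<noteq> {}" by auto
  ultimately show ?thesis using that by blast
qed

lemma proj_residual:
  assumes Q: "Q \<in> space M"
  shows "proj E x - proj Q (proj E x) = proj (Q\<^sup>\<bottom> \<inter> E) x" and "subspace (Q\<^sup>\<bottom> \<inter> E)" and "dim (Q\<^sup>\<bottom> \<inter> E) = N - q"
proof -
  have "proj Q (proj E x) = proj Q x"
    using Q in_M[OF Q] E(1)
    by (intro proj_eqI) (auto simp: proj_in inner_diff_left proj_inner subset_iff)
  then show "proj E x - proj Q (proj E x) = proj (Q\<^sup>\<bottom> \<inter> E) x"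
    using in_M[OF Q] by (simp add: proj_relative_complement E(1))
  show "subspace (Q\<^sup>\<bottom> \<inter> E)" using E(1) by (simp add: subspace_inter subspace_orthogonal_comp)
  show "dim (Q\<^sup>\<bottom> \<inter> E) = N - q" using in_M[OF Q] dim_relative_complement[of Q E] E by simp
qed

definition average_const :: "complex \<Rightarrow> complex" where
  "average_const b = gauss_moment CARD('n) (N - q) b / gauss_moment CARD('n) N b"

text \<open>By scaling, the average at \<open>y\<close> is \<open>|y|^b\<close> times its value \<open>g\<close> at a unit vector. Integrate the
average at \<open>proj E x\<close> against \<open>exp (-|x|^2)\<close>. This gives \<open>g\<close> times a Gaussian moment in dimension \<open>N\<close>;
with the integral over \<open>x\<close> done first, it gives a moment in dimension \<open>N - q\<close>, the same for every \<open>Q\<close>.\<close>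
lemma nn_integral_average:
  fixes b :: real
  assumes y: "y \<in> E" and b: "b + real (N - q) > 0"
  shows "(\<integral>\<^sup>+Q. ennreal (norm (y - proj Q y) powr b) \<partial>M) = ennreal (Re (average_const (of_real b)) * norm y powr b)"
    and "Re (average_const (of_real b)) > 0"
proof -
  obtain e where e: "e \<in> E" "norm e = 1" by (rule exists_unit)
  define g where "g = (\<integral>\<^sup>+Q. ennreal (norm (e - proj Q e) powr b) \<partial>M)"
  have g: "(\<integral>\<^sup>+Q. ennreal (norm (y - proj Q y) powr b) \<partial>M) = ennreal (norm y powr b) * g" if "y \<in> E" for y
  proof -
    have "(\<integral>\<^sup>+Q. ennreal (norm (y - proj Q y) powr b) \<partial>M) =
        (\<integral>\<^sup>+t. ennreal (t powr b) \<partial>distr M borel (\<lambda>Q. norm (y - proj Q y)))"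
      by (simp add: nn_integral_distr)
    also have "\<dots> = (\<integral>\<^sup>+Q. ennreal ((norm y * norm (e - proj Q e)) powr b) \<partial>M)"
      unfolding law_of_distance_scaling[OF that e] by (simp add: nn_integral_distr)
    also have "\<dots> = ennreal (norm y powr b) * g"
      unfolding g_def by (subst nn_integral_cmult[symmetric]) (auto simp: powr_mult ennreal_mult)
    finally show ?thesis .
  qed
  have gm: "gauss_moment CARD('n) d (of_real b) = of_real (sqrt pi ^ CARD('n) * Gamma ((d + b) / 2) / Gamma (d / 2))" for d
  proof -
    have "Gamma ((of_nat d + complex_of_real b) / 2) = of_real (Gamma ((d + b) / 2))"
      "Gamma (of_nat d / 2 :: complex) = of_real (Gamma (d / 2))"
      by (simp_all flip: Gamma_complex_of_real)
    then show ?thesis by (simp add: gauss_moment_def)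
  qed
  define m where "m d = sqrt pi ^ CARD('n) * Gamma ((d + b) / 2) / Gamma (d / 2)" for d :: nat
  have m_pos: "m d > 0" if "d > 0" "b + d > 0" for d
    using that unfolding m_def by (intro divide_pos_pos mult_pos_pos Gamma_real_pos) auto
  have mm: "m (N - q) > 0" "m N > 0" using qN b by (auto intro!: m_pos)
  have moment: "(\<integral>\<^sup>+x. ennreal (exp (- (norm x)\<^sup>2) * norm (proj W x) powr b) \<partial>lborel) = ennreal (m d)"
    if "subspace W" "dim W = d" "d > 0" "b + d > 0" for W :: "(real^'n) set" and d
  proof -
    have I: "has_bochner_integral lborel
      (\<lambda>x. exp (- (norm x)\<^sup>2) *\<^sub>R complex_of_real (norm (proj W x)) powr of_real b) (gauss_moment CARD('n) d (of_real b))"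
      using that by (intro has_bochner_integral_gauss_moment) auto
    show ?thesis using nn_integral_of_real_powr[OF I] by (simp add: gm m_def)
  qed
  note [measurable] = proj_measurable[OF E(1)]
  have "g * ennreal (m N) = (\<integral>\<^sup>+x. g * ennreal (exp (- (norm x)\<^sup>2) * norm (proj E x) powr b) \<partial>lborel)"
    using E qN b by (subst nn_integral_cmult) (auto simp: moment[OF E])
  also have "\<dots> = (\<integral>\<^sup>+x. \<integral>\<^sup>+Q. ennreal (exp (- (norm x)\<^sup>2) * norm (proj E x - proj Q (proj E x)) powr b) \<partial>M \<partial>lborel)"
    by (intro nn_integral_cong) (simp add: ennreal_mult nn_integral_cmult g proj_in E mult_ac)
  also have "\<dots> = (\<integral>\<^sup>+Q. \<integral>\<^sup>+x. ennreal (exp (- (norm x)\<^sup>2) * norm (proj E x - proj Q (proj E x)) powr b) \<partial>lborel \<partial>M)"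
    by (rule Fubini'[symmetric]) measurable
  also have "\<dots> = (\<integral>\<^sup>+Q. ennreal (m (N - q)) \<partial>M)"
    using qN b by (intro nn_integral_cong) (auto simp: proj_residual intro!: moment)
  also have "\<dots> = ennreal (m (N - q))" by (simp add: emeasure_space_1)
  finally have "g * ennreal (m N) = ennreal (m (N - q))" .
  then have "g = ennreal (m (N - q) / m N)"
    using mm by (metis divide_ennreal ennreal_eq_0_iff ennreal_mult_divide_eq ennreal_neq_top less_le_not_le less_imp_le)
  moreover have c: "Re (average_const (of_real b)) = m (N - q) / m N"
    by (simp only: average_const_def gm m_def flip: of_real_divide) simp
  ultimately show "(\<integral>\<^sup>+Q. ennreal (norm (y - proj Q y) powr b) \<partial>M) = ennreal (Re (average_const (of_real b)) * norm y powr b)"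
    using mm g[OF y] by (simp add: ennreal_mult[symmetric] mult.commute)
  show "Re (average_const (of_real b)) > 0" using mm c by simp
qed

text \<open>The argument is the one for real exponents, which now supplies the integrability that
Fubini's theorem asks for.\<close>
lemma has_bochner_integral_average:
  fixes b :: complex
  assumes y: "y \<in> E" and b: "Re b + real (N - q) > 0"
  shows "has_bochner_integral M (\<lambda>Q. complex_of_real (norm (y - proj Q y)) powr b)
    (average_const b * of_real (norm y) powr b)"
proof -
  obtain e where e: "e \<in> E" "norm e = 1" by (rule exists_unit)
  have int: "integrable M (\<lambda>Q. complex_of_real (norm (y - proj Q y)) powr b)" if "y \<in> E" for y
    using nn_integral_average(1)[OF that, of "Re b"] b by (intro integrableI_bounded) (auto simp: norm_of_real_powr)
  define g where "g = (LINT Q|M. complex_of_real (norm (e - proj Q e)) powr b)"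
  have g: "(LINT Q|M. complex_of_real (norm (y - proj Q y)) powr b) = of_real (norm y) powr b * g" if "y \<in> E" for y
  proof -
    have "(LINT Q|M. complex_of_real (norm (y - proj Q y)) powr b) =
        (LINT t|distr M borel (\<lambda>Q. norm (y - proj Q y)). complex_of_real t powr b)"
      by (simp add: integral_distr)
    also have "\<dots> = (LINT Q|M. complex_of_real (norm y * norm (e - proj Q e)) powr b)"
      unfolding law_of_distance_scaling[OF that e] by (simp add: integral_distr)
    also have "\<dots> = of_real (norm y) powr b * g"
      unfolding g_def by (simp add: of_real_mult_powr del: of_real_mult)
    finally show ?thesis .
  qed
  note [measurable] = proj_measurable[OF E(1)]
  define F where "F x Q = exp (- (norm x)\<^sup>2) *\<^sub>R complex_of_real (norm (proj E x - proj Q (proj E x))) powr b" for x Q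
  have F_int: "integrable (lborel \<Otimes>\<^sub>M M) (case_prod F)"
  proof (rule Fubini_integrable)
    show "case_prod F \<in> borel_measurable (lborel \<Otimes>\<^sub>M M)" unfolding F_def by measurable
    show "AE x in lborel. integrable M (\<lambda>Q. case_prod F (x, Q))"
      unfolding F_def by (simp add: int proj_in E)
    have "has_bochner_integral lborel
      (\<lambda>x. exp (- (norm x)\<^sup>2) *\<^sub>R complex_of_real (norm (proj E x)) powr of_real (Re b)) (gauss_moment CARD('n) N (of_real (Re b)))"
      using E qN b by (intro has_bochner_integral_gauss_moment) auto
    from has_bochner_integral_Re[OF this]
    have "integrable lborel (\<lambda>x. exp (- (norm x)\<^sup>2) * norm (proj E x) powr Re b)"
      by (simp add: has_bochner_integral_iff powr_of_real)
    moreover have "(LINT Q|M. norm (case_prod F (x, Q))) =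
       Re (average_const (of_real (Re b))) * (exp (- (norm x)\<^sup>2) * norm (proj E x) powr Re b)" for x
    proof -
      have "(LINT Q|M. norm (proj E x - proj Q (proj E x)) powr Re b) = Re (average_const (of_real (Re b))) * norm (proj E x) powr Re b"
        using nn_integral_average[of "proj E x" "Re b"] proj_in[OF E(1), of x] b
        by (intro integral_eq_nn_integral[THEN trans]) auto
      then show ?thesis by (simp add: F_def norm_of_real_powr)
    qed
    ultimately show "integrable lborel (\<lambda>x. LINT Q|M. norm (case_prod F (x, Q)))" by simp
  qed
  have moment: "(LINT x|lborel. exp (- (norm x)\<^sup>2) *\<^sub>R complex_of_real (norm (proj W x)) powr b) = gauss_moment CARD('n) d b"
    if "subspace W" "dim W = d" "d > 0" "Re b + d > 0" for W :: "(real^'n) set" and d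
    using that by (intro has_bochner_integral_integral_eq has_bochner_integral_gauss_moment) auto
  have "g * gauss_moment CARD('n) N b = (LINT x|lborel. g * (exp (- (norm x)\<^sup>2) *\<^sub>R complex_of_real (norm (proj E x)) powr b))"
    using E qN b by (subst integral_mult_right_zero) (simp add: moment)
  also have "\<dots> = (LINT x|lborel. LINT Q|M. F x Q)"
    by (intro Bochner_Integration.integral_cong refl) (simp add: F_def g proj_in E mult_ac)
  also have "\<dots> = (LINT Q|M. LINT x|lborel. F x Q)"
    by (rule Fubini_integral[OF F_int, symmetric])
  also have "\<dots> = (LINT Q|M. gauss_moment CARD('n) (N - q) b)"
    using qN b unfolding F_def by (intro Bochner_Integration.integral_cong refl) (auto simp: proj_residual intro!: moment)
  also have "\<dots> = gauss_moment CARD('n) (N - q) b" by (simp add: prob_space)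
  finally have "g * gauss_moment CARD('n) N b = gauss_moment CARD('n) (N - q) b" .
  moreover have "gauss_moment CARD('n) N b \<noteq> 0"
    using qN b by (auto simp: gauss_moment_def intro!: Gamma_nonzero_of_Re_pos)
  ultimately have "g = average_const b" by (simp add: average_const_def field_simps)
  then show ?thesis using g[OF y] int[OF y] by (simp add: has_bochner_integral_iff mult.commute)
qed

end

lemma AE_subspace_lborel:
  fixes X :: "(real^'n) set"
  assumes X: "subspace X"
  shows "AE u in subspace_lborel X. u \<in> X"
proof -
  have [measurable]: "X \<in> sets borel" using closed_subspace[OF X] by simp
  note [measurable] = proj_measurable[OF X] gauss_weight_measurable[OF X]
  show ?thesis unfolding subspace_lborel_eq_distr[OF X]
    by (subst AE_distr_iff) (auto simp: proj_in[OF X])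
qed

text \<open>The image under \<open>|u|^2\<close> has a finite density, so it is \<open>\<sigma>\<close>-finite, and then the measure itself is.\<close>
lemma sigma_finite_subspace_lborel:
  fixes X :: "(real^'n) set"
  assumes X: "subspace X" "dim X > 0"
  shows "sigma_finite_measure (subspace_lborel X)"
proof (rule sigma_finite_measure_distr)
  show "(\<lambda>u. (norm u)\<^sup>2) \<in> subspace_lborel X \<rightarrow>\<^sub>M borel" by measurable
  show "sigma_finite_measure (distr (subspace_lborel X) borel (\<lambda>u. (norm u)\<^sup>2))"
    unfolding distr_norm_square_subspace_lborel[OF X]
    by (subst sigma_finite_measure.sigma_finite_iff_density_finite[OF sigma_finite_lborel]) auto
qed

section \<open>Semyanistyi integrals of Borel functions\<close>

lemma lebesgue_ex_borel_complex:
  fixes f :: "'a::euclidean_space \<Rightarrow> complex"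
  assumes f: "f \<in> borel_measurable lebesgue"
  obtains g where "g \<in> borel_measurable borel" "AE x in lebesgue. f x = g x"
proof -
  have "(\<lambda>x. Re (f x)) \<in> borel_measurable lebesgue" "(\<lambda>x. Im (f x)) \<in> borel_measurable lebesgue"
    using f by measurable
  from this[THEN completion_ex_borel_measurable_real]
  obtain a b where a: "a \<in> borel_measurable lborel" "AE x in lborel. Re (f x) = a x"
    and b: "b \<in> borel_measurable lborel" "AE x in lborel. Im (f x) = b x" by blast
  have "(\<lambda>x. Complex (a x) (b x)) \<in> borel_measurable borel"
    using a(1) b(1) by (subst borel_measurable_complex_iff) simp
  moreover have "AE x in lebesgue. f x = Complex (a x) (b x)"
    using AE_completion[OF a(2)] AE_completion[OF b(2)] by eventually_elim (simp add: complex_eq_iff)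
  ultimately show ?thesis using that by blast
qed

lemma semyanistyi_integrand_measurable:
  assumes "f \<in> borel_measurable M" "sets borel \<subseteq> sets M" "space M = UNIV"
  shows "semyanistyi_integrand m \<alpha> f \<zeta> \<in> borel_measurable M"
proof -
  have [measurable]: "(\<lambda>x. infdist x \<zeta>) \<in> borel_measurable (borel :: (real^'a) measure)"
    by (intro borel_measurable_continuous_onI continuous_intros)
  have "(\<lambda>x. complex_of_real (infdist x \<zeta>) powr (\<alpha> + of_nat m - of_nat CARD('a))) \<in> borel_measurable (borel :: (real^'a) measure)"
    by measurable
  then have "(\<lambda>x. complex_of_real (infdist x \<zeta>) powr (\<alpha> + of_nat m - of_nat CARD('a))) \<in> borel_measurable M"
    using assms by (auto simp: measurable_def)
  then show ?thesis unfolding semyanistyi_integrand_def[abs_def] using assms(1) by measurable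
qed

lemma norm_semyanistyi_integrand:
  "norm (semyanistyi_integrand m \<alpha> f \<zeta> x) =
     norm (f x) * infdist (x :: real^'n) \<zeta> powr (Re \<alpha> + real m - real CARD('n))"
  by (simp add: semyanistyi_integrand_def norm_mult norm_of_real_powr infdist_nonneg)

text \<open>Changing \<open>f\<close> on a null set does not change the integrals for any plane. A Lebesgue measurable \<open>f\<close> may
therefore be replaced by a Borel function, and Fubini's theorem applied to products of Borel measures.\<close>
lemma semyanistyi_cong_AE:
  fixes f g :: "real^'n \<Rightarrow> complex"
  assumes f: "f \<in> borel_measurable lebesgue" and g: "g \<in> borel_measurable borel"
    and ae: "AE x in lebesgue. f x = g x"
  shows "semyanistyi_nn m \<alpha> f = semyanistyi_nn m \<alpha> g" "semyanistyi m \<alpha> f = semyanistyi m \<alpha> g"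
proof -
  have g': "g \<in> borel_measurable lebesgue" using g by (simp add: measurable_completion)
  have eq: "AE x in lebesgue. semyanistyi_integrand m \<alpha> f \<zeta> x = semyanistyi_integrand m \<alpha> g \<zeta> x" for \<zeta>
    using ae by eventually_elim (simp add: semyanistyi_integrand_def)
  show "semyanistyi_nn m \<alpha> f = semyanistyi_nn m \<alpha> g"
    unfolding semyanistyi_nn_def
  proof (rule ext, rule nn_integral_cong_AE)
    show "AE x in lebesgue. ennreal (norm (semyanistyi_integrand m \<alpha> f \<zeta> x)) = ennreal (norm (semyanistyi_integrand m \<alpha> g \<zeta> x))" for \<zeta>
      using eq[of \<zeta>] by eventually_elim simp
  qed
  have "(LINT x|lebesgue. semyanistyi_integrand m \<alpha> f \<zeta> x) = (LINT x|lebesgue. semyanistyi_integrand m \<alpha> g \<zeta> x)" for \<zeta>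
    using f g' eq by (intro integral_cong_AE semyanistyi_integrand_measurable) auto
  then show "semyanistyi m \<alpha> f = semyanistyi m \<alpha> g" unfolding semyanistyi_def by auto
qed

lemma semyanistyi_borel:
  fixes f :: "real^'n \<Rightarrow> complex"
  assumes f: "f \<in> borel_measurable borel"
  shows "semyanistyi_nn m \<alpha> f \<zeta> = (\<integral>\<^sup>+x. ennreal (norm (f x) * infdist x \<zeta> powr (Re \<alpha> + real m - real CARD('n))) \<partial>lborel)"
    and "semyanistyi m \<alpha> f \<zeta> = 1 / riesz_gamma (CARD('n) - m) \<alpha> *
      (LINT x|lborel. f x * complex_of_real (infdist x \<zeta>) powr (\<alpha> + of_nat m - of_nat CARD('n)))"
proof -
  have meas: "semyanistyi_integrand m \<alpha> f \<zeta> \<in> borel_measurable lborel"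
    using f by (intro semyanistyi_integrand_measurable) auto
  show "semyanistyi_nn m \<alpha> f \<zeta> = (\<integral>\<^sup>+x. ennreal (norm (f x) * infdist x \<zeta> powr (Re \<alpha> + real m - real CARD('n))) \<partial>lborel)"
    unfolding semyanistyi_nn_def by (subst nn_integral_completion) (simp add: norm_semyanistyi_integrand)
  show "semyanistyi m \<alpha> f \<zeta> = 1 / riesz_gamma (CARD('n) - m) \<alpha> *
      (LINT x|lborel. f x * complex_of_real (infdist x \<zeta>) powr (\<alpha> + of_nat m - of_nat CARD('n)))"
    unfolding semyanistyi_def integral_completion[OF meas] by (simp add: semyanistyi_integrand_def[abs_def])
qed

section \<open>The Strichartz transform of a Semyanistyi integral\<close>

text \<open>\<open>MP\<close> and \<open>MQ\<close> are the invariant measures over which \<open>P\<close> and \<open>Q\<close> are averaged.\<close>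
locale strichartz_setting =
  fixes \<eta> :: "(real^'n) set" and v :: "real^'n" and p q l :: nat and MP MQ :: "(real^'n) set measure"
  assumes \<eta>: "subspace \<eta>" "dim \<eta> = p + l" and l: "l > 0" and n: "p + q + l < CARD('n)" and v: "v \<in> \<eta>\<^sup>\<bottom>"
    and MP: "invariant_grassmann_measure \<eta> p MP" and MQ: "invariant_grassmann_measure (\<eta>\<^sup>\<bottom>) q MQ"
begin

definition N where "N = CARD('n) - (p + l)"

lemma complement: "subspace (\<eta>\<^sup>\<bottom>)" "dim (\<eta>\<^sup>\<bottom>) = N"
  using dim_relative_complement[OF \<eta>(1) subspace_UNIV] \<eta>(2) by (simp_all add: subspace_orthogonal_comp N_def)

lemma qN: "q < N" using n by (simp add: N_def)

sublocale P: grassmann_average \<eta> p "p + l" MP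
  using \<eta> l MP by unfold_locales auto

sublocale Q: grassmann_average "\<eta>\<^sup>\<bottom>" q N MQ
  using complement qN MQ by unfold_locales auto

text \<open>The component of \<open>x - v\<close> orthogonal to \<open>\<eta>\<close>; its norm is the distance of \<open>x\<close> from \<open>\<eta> + v\<close>.\<close>
definition offset :: "real^'n \<Rightarrow> real^'n" where
  "offset x = proj (\<eta>\<^sup>\<bottom>) x - v"

lemma offset_in: "offset x \<in> \<eta>\<^sup>\<bottom>"
  unfolding offset_def using complement(1) v by (intro subspace_diff proj_in)

lemma offset_measurable [measurable]: "offset \<in> borel_measurable borel"
  using proj_measurable[OF complement(1)] unfolding offset_def[abs_def] by measurable

text \<open>The distance of the offset from \<open>Q\<close>, which is the part of the distance from \<open>x\<close> to \<open>[P,Q] + u + v\<close>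
that depends neither on \<open>P\<close> nor on \<open>u\<close>.\<close>
definition gap :: "(real^'n) set \<Rightarrow> real^'n \<Rightarrow> real" where
  "gap Q x = norm (offset x - proj Q (offset x))"

lemma gap_nonneg: "0 \<le> gap Q x" by (simp add: gap_def)

lemma gap_measurable [measurable (raw)]:
  assumes [measurable]: "V \<in> M \<rightarrow>\<^sub>M MQ" "x \<in> borel_measurable M"
  shows "(\<lambda>a. gap (V a) (x a)) \<in> borel_measurable M"
proof -
  have [measurable]: "V \<in> M \<rightarrow>\<^sub>M grassmannian_borel (\<eta>\<^sup>\<bottom>) q"
    using assms(1) by (simp add: measurable_cong_sets[OF refl Q.sets_M])
  show ?thesis unfolding gap_def by measurable
qed

text \<open>A formula for the distance of \<open>x\<close> from \<open>[P,Q] + u + v\<close> in terms of the projections to \<open>P\<close> and \<open>Q\<close>,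
from which joint measurability can be read off.\<close>
definition plane_dist :: "(real^'n) set \<Rightarrow> (real^'n) set \<Rightarrow> real^'n \<Rightarrow> real^'n \<Rightarrow> real" where
  "plane_dist P Q u x = norm ((x - (u + v)) - proj P (x - (u + v)) - proj Q (x - (u + v)))"

lemma plane_dist_nonneg: "0 \<le> plane_dist P Q u x" by (simp add: plane_dist_def)

lemma infdist_plane:
  assumes P: "P \<in> space MP" and Q: "Q \<in> space MQ"
  shows "infdist x (join_plane P Q (u + v)) = plane_dist P Q u x"
proof -
  have "Q \<subseteq> P\<^sup>\<bottom>"
    using P.in_M[OF P] Q.in_M[OF Q] orthogonal_comp_anti_mono[of P \<eta>] by blast
  then show ?thesis
    unfolding plane_dist_def using P.in_M[OF P] Q.in_M[OF Q] by (intro infdist_join_plane) auto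
qed

lemma infdist_base_plane: "infdist x ((+) v ` \<eta>) = norm (offset x)"
  unfolding infdist_affine_subspace[OF \<eta>(1)] using v \<eta>(1)
  by (simp add: offset_def proj_diff proj_orthogonal_comp proj_orthogonal_comp_eq_0 algebra_simps)

lemma fibre_space:
  assumes P: "P \<in> space MP"
  shows "subspace (P\<^sup>\<bottom> \<inter> \<eta>)" "dim (P\<^sup>\<bottom> \<inter> \<eta>) = l"
  using P.proj_residual[OF P] by auto

text \<open>The residual vector splits into a part in \<open>\<eta>\<close>, where \<open>Q\<close> and \<open>v\<close> do not contribute, and a part in
\<open>\<eta>\<^sup>\<bottom>\<close>, where \<open>P\<close> and \<open>u\<close> do not.\<close>
lemma plane_dist_eq:
  assumes P: "P \<in> space MP" and Q: "Q \<in> space MQ" and u: "u \<in> P\<^sup>\<bottom> \<inter> \<eta>"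
  shows "plane_dist P Q u x = sqrt ((norm (u - proj (P\<^sup>\<bottom> \<inter> \<eta>) x))\<^sup>2 + (gap Q x)\<^sup>2)"
proof -
  have sP: "subspace P" "P \<subseteq> \<eta>" and sQ: "subspace Q" "Q \<subseteq> \<eta>\<^sup>\<bottom>" using P.in_M[OF P] Q.in_M[OF Q] by auto
  define a where "a = proj (P\<^sup>\<bottom> \<inter> \<eta>) x - u"
  define c where "c = offset x - proj Q (offset x)"
  have "v \<in> P\<^sup>\<bottom>" using v orthogonal_comp_anti_mono[OF sP(2)] by blast
  then have pP: "proj P (x - (u + v)) = proj P x"
    using u sP by (simp add: proj_diff proj_add proj_orthogonal_comp_eq_0)
  have "u \<in> Q\<^sup>\<bottom>" using u sQ(2) orthogonal_comp_anti_mono[OF sQ(2)] orthogonal_comp_subset[of \<eta>] by blast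
  then have pQu: "proj Q u = 0" using sQ by (simp add: proj_orthogonal_comp_eq_0)
  have "proj Q (proj (\<eta>\<^sup>\<bottom>) x) = proj Q x"
    using sQ complement(1) by (intro proj_eqI) (auto simp: proj_in inner_diff_left proj_inner subset_iff)
  then have pQ: "proj Q (x - (u + v)) = proj Q (offset x)"
    using sQ pQu by (simp add: proj_diff proj_add offset_def)
  have "(x - (u + v)) - proj P (x - (u + v)) - proj Q (x - (u + v)) = a + c"
    unfolding pP pQ a_def c_def offset_def
    using sP \<eta>(1) by (simp add: proj_relative_complement proj_orthogonal_comp algebra_simps)
  moreover have "a \<bullet> c = 0"
  proof -
    have "a \<in> \<eta>" unfolding a_def using u \<eta>(1) proj_in[OF fibre_space(1)[OF P]] by (auto intro: subspace_diff)
    moreover have "c \<in> \<eta>\<^sup>\<bottom>" unfolding c_def using offset_in proj_in[OF sQ(1)] sQ(2) complement(1) by (auto intro: subspace_diff)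
    ultimately show ?thesis by (auto simp: orthogonal_comp_def orthogonal_def)
  qed
  then have "(norm (a + c))\<^sup>2 = (norm a)\<^sup>2 + (norm c)\<^sup>2"
    by (simp add: power2_norm_eq_inner inner_add_left inner_add_right inner_commute)
  ultimately have "(plane_dist P Q u x)\<^sup>2 = (norm a)\<^sup>2 + (norm c)\<^sup>2" by (simp add: plane_dist_def)
  then show ?thesis
    unfolding a_def c_def gap_def[symmetric] by (metis norm_minus_commute plane_dist_nonneg real_sqrt_unique gap_def)
qed

text \<open>If the gap is \<open>0\<close>, then \<open>x - v\<close> is orthogonal to every vector of \<open>Q\<^sup>\<bottom> \<inter> \<eta>\<^sup>\<bottom>\<close>, which is not the zero
space since \<open>q < N\<close>. So \<open>x\<close> lies in a fixed hyperplane.\<close>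
lemma AE_gap_pos:
  assumes Q: "Q \<in> space MQ"
  shows "AE x in lborel. gap Q x > 0"
proof -
  have W: "subspace (Q\<^sup>\<bottom> \<inter> \<eta>\<^sup>\<bottom>)" "dim (Q\<^sup>\<bottom> \<inter> \<eta>\<^sup>\<bottom>) > 0" using Q.proj_residual[OF Q] qN by auto
  then obtain e where e: "e \<in> Q\<^sup>\<bottom> \<inter> \<eta>\<^sup>\<bottom>" "e \<noteq> 0" by (metis dim_eq_0 less_irrefl subsetI singleton_iff)
  have "negligible {x. e \<bullet> x = e \<bullet> v}" using e(2) by (intro negligible_hyperplane) simp
  then have "{x. e \<bullet> x = e \<bullet> v} \<in> null_sets lebesgue" by (simp add: negligible_iff_null_sets)
  then have "AE x in lebesgue. x \<notin> {x. e \<bullet> x = e \<bullet> v}" by (rule AE_not_in)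
  then have "AE x in lborel. x \<notin> {x. e \<bullet> x = e \<bullet> v}" by (simp add: AE_completion_iff)
  then show ?thesis
  proof eventually_elim
    fix x assume x: "x \<notin> {x. e \<bullet> x = e \<bullet> v}"
    show "gap Q x > 0"
    proof (rule ccontr)
      assume "\<not> gap Q x > 0"
      then have "offset x = proj Q (offset x)" by (simp add: gap_def)
      then have "offset x \<in> Q" using proj_in[of Q "offset x"] Q.in_M[OF Q] by simp
      then have "offset x \<bullet> e = 0" using e by (auto simp: orthogonal_comp_def orthogonal_def)
      then have "x \<bullet> e = v \<bullet> e" using e complement(1) by (simp add: offset_def inner_diff_left proj_inner)
      then show False using x by (simp add: inner_commute)
    qed
  qed
qed

lemma plane_dist_measurable:
  assumes [measurable]: "V \<in> M \<rightarrow>\<^sub>M MP" "W \<in> M \<rightarrow>\<^sub>M MQ" "u \<in> borel_measurable M" "x \<in> borel_measurable M"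
  shows "(\<lambda>a. plane_dist (V a) (W a) (u a) (x a)) \<in> borel_measurable M"
proof -
  have [measurable]: "W \<in> M \<rightarrow>\<^sub>M grassmannian_borel (\<eta>\<^sup>\<bottom>) q"
    using assms(2) by (simp add: measurable_cong_sets[OF refl Q.sets_M])
  have [measurable]: "V \<in> M \<rightarrow>\<^sub>M grassmannian_borel \<eta> p"
    using assms(1) by (simp add: measurable_cong_sets[OF refl P.sets_M])
  show ?thesis unfolding plane_dist_def by measurable
qed

lemma plane_dist_measurable_fixed:
  assumes "P \<in> space MP" "Q \<in> space MQ" and [measurable]: "u \<in> borel_measurable M" "x \<in> borel_measurable M"
  shows "(\<lambda>a. plane_dist P Q (u a) (x a)) \<in> borel_measurable M"
  by (rule plane_dist_measurable) (use assms in auto)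

context
  fixes f :: "real^'n \<Rightarrow> complex" and \<alpha> b :: complex
  assumes f [measurable]: "f \<in> borel_measurable borel"
  defines "b \<equiv> \<alpha> + of_nat (p + q) - of_nat CARD('n)"
begin

lemma semyanistyi_nn_plane:
  assumes P: "P \<in> space MP" and Q: "Q \<in> space MQ"
  shows "(\<integral>\<^sup>+u. semyanistyi_nn (p + q) \<alpha> f (join_plane P Q (u + v)) \<partial>subspace_lborel (P\<^sup>\<bottom> \<inter> \<eta>)) =
    (\<integral>\<^sup>+x. ennreal (norm (f x)) *
      (\<integral>\<^sup>+u. ennreal (sqrt ((norm (u - proj (P\<^sup>\<bottom> \<inter> \<eta>) x))\<^sup>2 + (gap Q x)\<^sup>2) powr Re b) \<partial>subspace_lborel (P\<^sup>\<bottom> \<inter> \<eta>)) \<partial>lborel)"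
proof -
  let ?X = "P\<^sup>\<bottom> \<inter> \<eta>"
  interpret X: sigma_finite_measure "subspace_lborel ?X"
    using fibre_space[OF P] l by (intro sigma_finite_subspace_lborel) auto
  interpret pair_sigma_finite "subspace_lborel ?X" lborel ..
  note [measurable] = plane_dist_measurable_fixed[OF P Q]
  have "(\<integral>\<^sup>+u. semyanistyi_nn (p + q) \<alpha> f (join_plane P Q (u + v)) \<partial>subspace_lborel ?X) =
    (\<integral>\<^sup>+u. \<integral>\<^sup>+x. ennreal (norm (f x)) * ennreal (plane_dist P Q u x powr Re b) \<partial>lborel \<partial>subspace_lborel ?X)"
    by (simp add: semyanistyi_borel(1)[OF f] infdist_plane[OF P Q] b_def ennreal_mult)
  also have "\<dots> = (\<integral>\<^sup>+x. \<integral>\<^sup>+u. ennreal (norm (f x)) * ennreal (plane_dist P Q u x powr Re b) \<partial>subspace_lborel ?X \<partial>lborel)"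
    by (rule Fubini'[symmetric]) measurable
  also have "\<dots> = (\<integral>\<^sup>+x. ennreal (norm (f x)) * (\<integral>\<^sup>+u. ennreal (plane_dist P Q u x powr Re b) \<partial>subspace_lborel ?X) \<partial>lborel)"
    by (intro nn_integral_cong nn_integral_cmult) measurable
  also have "\<dots> = (\<integral>\<^sup>+x. ennreal (norm (f x)) *
      (\<integral>\<^sup>+u. ennreal (sqrt ((norm (u - proj ?X x))\<^sup>2 + (gap Q x)\<^sup>2) powr Re b) \<partial>subspace_lborel ?X) \<partial>lborel)"
  proof (rule nn_integral_cong)
    fix x
    have "AE u in subspace_lborel ?X. ennreal (plane_dist P Q u x powr Re b) =
       ennreal (sqrt ((norm (u - proj ?X x))\<^sup>2 + (gap Q x)\<^sup>2) powr Re b)"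
      using AE_subspace_lborel[OF fibre_space(1)[OF P]] by eventually_elim (simp add: plane_dist_eq[OF P Q])
    from nn_integral_cong_AE[OF this]
    show "ennreal (norm (f x)) * (\<integral>\<^sup>+u. ennreal (plane_dist P Q u x powr Re b) \<partial>subspace_lborel ?X) =
      ennreal (norm (f x)) *
      (\<integral>\<^sup>+u. ennreal (sqrt ((norm (u - proj ?X x))\<^sup>2 + (gap Q x)\<^sup>2) powr Re b) \<partial>subspace_lborel ?X)" by simp
  qed
  finally show ?thesis .
qed

text \<open>For each \<open>P\<close> and \<open>Q\<close> the integral is that of \<open>|f|\<close> times \<open>\<infinity>\<close>.\<close>
lemma AE_zero_if_strichartz_nn_finite:
  assumes G: "G \<eta> p = MP" "G (\<eta>\<^sup>\<bottom>) q = MQ"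
    and b: "Re b + l \<ge> 0" and fin: "strichartz_nn G p q (semyanistyi_nn (p + q) \<alpha> f) \<eta> v < \<infinity>"
  shows "AE x in lborel. f x = 0"
proof -
  have inner: "(\<integral>\<^sup>+u. semyanistyi_nn (p + q) \<alpha> f (join_plane P Q (u + v)) \<partial>subspace_lborel (P\<^sup>\<bottom> \<inter> \<eta>)) =
      (\<integral>\<^sup>+x. ennreal (norm (f x)) * \<infinity> \<partial>lborel)" if "P \<in> space MP" "Q \<in> space MQ" for P Q
    unfolding semyanistyi_nn_plane[OF that]
    using nn_integral_fibre_infinite[OF fibre_space(1)[OF that(1)] fibre_space(2)[OF that(1)] l proj_in[OF fibre_space(1)[OF that(1)]] b]
    by simp
  have "strichartz_nn G p q (semyanistyi_nn (p + q) \<alpha> f) \<eta> v =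
      (\<integral>\<^sup>+Q. \<integral>\<^sup>+P. (\<integral>\<^sup>+x. ennreal (norm (f x)) * \<infinity> \<partial>lborel) \<partial>MP \<partial>MQ)"
    unfolding strichartz_nn_def G by (intro nn_integral_cong) (simp add: inner cong: nn_integral_cong)
  also have "\<dots> = (\<integral>\<^sup>+x. ennreal (norm (f x)) * \<infinity> \<partial>lborel)"
    by (simp add: P.emeasure_space_1 Q.emeasure_space_1)
  finally have "(\<integral>\<^sup>+x. ennreal (norm (f x)) * \<infinity> \<partial>lborel) \<noteq> \<infinity>" using fin by simp
  then have "AE x in lborel. ennreal (norm (f x)) * \<infinity> \<noteq> \<infinity>" by (intro nn_integral_PInf_AE) auto
  then show ?thesis by eventually_elim (auto simp: ennreal_mult_top split: if_splits)
qed

context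
  assumes b: "Re b + l < 0" and \<alpha>: "Re \<alpha> > 0"
begin

lemma exponent_ok: "Re b + real l + real (N - q) > 0"
  using \<alpha> n qN by (simp add: b_def N_def of_nat_diff)

lemma nn_integral_over_fibre:
  assumes P: "P \<in> space MP" and Q: "Q \<in> space MQ"
  shows "(\<integral>\<^sup>+u. semyanistyi_nn (p + q) \<alpha> f (join_plane P Q (u + v)) \<partial>subspace_lborel (P\<^sup>\<bottom> \<inter> \<eta>)) =
    ennreal (Re (fibre_const l (of_real (Re b)))) * (\<integral>\<^sup>+x. ennreal (norm (f x) * gap Q x powr (Re b + l)) \<partial>lborel)"
proof -
  have [measurable]: "gap Q \<in> borel_measurable borel"
    using gap_measurable[of "\<lambda>_. Q" borel "\<lambda>x. x"] Q by simp
  have pos: "0 \<le> Re (fibre_const l (of_real (Re b)))"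
    using fibre_const_pos[where b = "Re b" and l = l] b by simp
  have "(\<integral>\<^sup>+u. semyanistyi_nn (p + q) \<alpha> f (join_plane P Q (u + v)) \<partial>subspace_lborel (P\<^sup>\<bottom> \<inter> \<eta>)) =
    (\<integral>\<^sup>+x. ennreal (Re (fibre_const l (of_real (Re b)))) * ennreal (norm (f x) * gap Q x powr (Re b + l)) \<partial>lborel)"
    unfolding semyanistyi_nn_plane[OF P Q]
  proof (rule nn_integral_cong_AE)
    show "AE x in lborel. ennreal (norm (f x)) *
      (\<integral>\<^sup>+u. ennreal (sqrt ((norm (u - proj (P\<^sup>\<bottom> \<inter> \<eta>) x))\<^sup>2 + (gap Q x)\<^sup>2) powr Re b) \<partial>subspace_lborel (P\<^sup>\<bottom> \<inter> \<eta>)) =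
      ennreal (Re (fibre_const l (of_real (Re b)))) * ennreal (norm (f x) * gap Q x powr (Re b + l))"
      using AE_gap_pos[OF Q]
      by eventually_elim
        (simp add: nn_integral_fibre[OF fibre_space[OF P] l proj_in[OF fibre_space(1)[OF P]] _ b] pos ennreal_mult mult_ac)
  qed
  then show ?thesis by (simp add: nn_integral_cmult)
qed

lemma nn_integral_over_transversals:
  "(\<integral>\<^sup>+Q. \<integral>\<^sup>+x. ennreal (norm (f x) * gap Q x powr (Re b + l)) \<partial>lborel \<partial>MQ) =
    ennreal (Re (Q.average_const (of_real (Re b + l)))) * semyanistyi_nn (p + l) (of_nat q + \<alpha>) f ((+) v ` \<eta>)"
proof -
  have pos: "0 \<le> Re (Q.average_const (of_real (Re b + l)))"
    using Q.nn_integral_average(2)[OF offset_in, of "Re b + l"] exponent_ok by simp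
  have "(\<integral>\<^sup>+Q. \<integral>\<^sup>+x. ennreal (norm (f x) * gap Q x powr (Re b + l)) \<partial>lborel \<partial>MQ) =
      (\<integral>\<^sup>+x. \<integral>\<^sup>+Q. ennreal (norm (f x) * gap Q x powr (Re b + l)) \<partial>MQ \<partial>lborel)"
    by (rule Q.Fubini') measurable
  also have "\<dots> = (\<integral>\<^sup>+x. ennreal (norm (f x)) * (\<integral>\<^sup>+Q. ennreal (gap Q x powr (Re b + l)) \<partial>MQ) \<partial>lborel)"
    by (simp add: ennreal_mult nn_integral_cmult)
  also have "\<dots> = (\<integral>\<^sup>+x. ennreal (Re (Q.average_const (of_real (Re b + l)))) * ennreal (norm (f x) * norm (offset x) powr (Re b + l)) \<partial>lborel)"
    unfolding gap_def using exponent_ok pos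
    by (simp add: Q.nn_integral_average(1)[OF offset_in] ennreal_mult mult_ac del: of_real_add)
  also have "\<dots> = ennreal (Re (Q.average_const (of_real (Re b + l)))) * (\<integral>\<^sup>+x. ennreal (norm (f x) * norm (offset x) powr (Re b + l)) \<partial>lborel)"
    by (rule nn_integral_cmult) measurable
  also have "(\<integral>\<^sup>+x. ennreal (norm (f x) * norm (offset x) powr (Re b + l)) \<partial>lborel) =
      semyanistyi_nn (p + l) (of_nat q + \<alpha>) f ((+) v ` \<eta>)"
    unfolding semyanistyi_borel(1)[OF f] infdist_base_plane by (simp add: b_def algebra_simps)
  finally show ?thesis .
qed

lemma strichartz_nn_eq:
  assumes G: "G \<eta> p = MP" "G (\<eta>\<^sup>\<bottom>) q = MQ"
  shows "strichartz_nn G p q (semyanistyi_nn (p + q) \<alpha> f) \<eta> v =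
    ennreal (Re (fibre_const l (of_real (Re b))) * Re (Q.average_const (of_real (Re b + l)))) *
      semyanistyi_nn (p + l) (of_nat q + \<alpha>) f ((+) v ` \<eta>)"
proof -
  have "strichartz_nn G p q (semyanistyi_nn (p + q) \<alpha> f) \<eta> v =
    (\<integral>\<^sup>+Q. \<integral>\<^sup>+P. ennreal (Re (fibre_const l (of_real (Re b)))) * (\<integral>\<^sup>+x. ennreal (norm (f x) * gap Q x powr (Re b + l)) \<partial>lborel) \<partial>MP \<partial>MQ)"
    unfolding strichartz_nn_def G by (intro nn_integral_cong) (simp add: nn_integral_over_fibre cong: nn_integral_cong)
  also have "\<dots> = ennreal (Re (fibre_const l (of_real (Re b)))) *
     (\<integral>\<^sup>+Q. \<integral>\<^sup>+x. ennreal (norm (f x) * gap Q x powr (Re b + l)) \<partial>lborel \<partial>MQ)"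
    by (simp add: P.emeasure_space_1 nn_integral_cmult)
  also have "\<dots> = ennreal (Re (fibre_const l (of_real (Re b)))) *
     (ennreal (Re (Q.average_const (of_real (Re b + l)))) * semyanistyi_nn (p + l) (of_nat q + \<alpha>) f ((+) v ` \<eta>))"
    by (simp only: nn_integral_over_transversals)
  finally show ?thesis
    using fibre_const_pos[where b = "Re b" and l = l] b by (simp add: ennreal_mult' mult.assoc)
qed

lemma integral_over_fibre:
  assumes P: "P \<in> space MP" and Q: "Q \<in> space MQ"
    and fin: "(\<integral>\<^sup>+x. ennreal (norm (f x) * gap Q x powr (Re b + l)) \<partial>lborel) < \<infinity>"
  shows "(LINT u|subspace_lborel (P\<^sup>\<bottom> \<inter> \<eta>). semyanistyi (p + q) \<alpha> f (join_plane P Q (u + v))) =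
    1 / riesz_gamma (CARD('n) - (p + q)) \<alpha> * fibre_const l b *
      (LINT x|lborel. f x * complex_of_real (gap Q x) powr (b + of_nat l))"
proof -
  let ?X = "P\<^sup>\<bottom> \<inter> \<eta>"
  interpret X: sigma_finite_measure "subspace_lborel ?X"
    using fibre_space[OF P] l by (intro sigma_finite_subspace_lborel) auto
  interpret pair_sigma_finite "subspace_lborel ?X" lborel ..
  note [measurable] = plane_dist_measurable_fixed[OF P Q]
  have [measurable]: "gap Q \<in> borel_measurable borel"
    using gap_measurable[of "\<lambda>_. Q" borel "\<lambda>x. x"] Q by simp
  define F where "F u x = f x * complex_of_real (plane_dist P Q u x) powr b" for u x
  have [measurable]: "case_prod F \<in> borel_measurable (subspace_lborel ?X \<Otimes>\<^sub>M lborel)"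
    unfolding F_def by measurable
  have F_int: "integrable (subspace_lborel ?X \<Otimes>\<^sub>M lborel) (case_prod F)"
  proof (rule integrableI_bounded)
    have "(\<integral>\<^sup>+z. ennreal (norm (case_prod F z)) \<partial>(subspace_lborel ?X \<Otimes>\<^sub>M lborel)) =
        (\<integral>\<^sup>+u. \<integral>\<^sup>+x. ennreal (norm (case_prod F (u, x))) \<partial>lborel \<partial>subspace_lborel ?X)"
      by (rule lborel.nn_integral_fst[symmetric]) measurable
    also have "\<dots> = (\<integral>\<^sup>+u. semyanistyi_nn (p + q) \<alpha> f (join_plane P Q (u + v)) \<partial>subspace_lborel ?X)"
      unfolding semyanistyi_borel(1)[OF f] infdist_plane[OF P Q]
      by (simp add: F_def norm_mult norm_of_real_powr plane_dist_nonneg b_def)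
    also have "\<dots> < \<infinity>" unfolding nn_integral_over_fibre[OF P Q] using fin by (simp add: ennreal_mult_less_top)
    finally show "(\<integral>\<^sup>+z. ennreal (norm (case_prod F z)) \<partial>(subspace_lborel ?X \<Otimes>\<^sub>M lborel)) < \<infinity>" .
  qed measurable
  have "(LINT u|subspace_lborel ?X. semyanistyi (p + q) \<alpha> f (join_plane P Q (u + v))) =
      (LINT u|subspace_lborel ?X. 1 / riesz_gamma (CARD('n) - (p + q)) \<alpha> * (LINT x|lborel. F u x))"
    unfolding semyanistyi_borel(2)[OF f] infdist_plane[OF P Q] F_def b_def ..
  also have "\<dots> = 1 / riesz_gamma (CARD('n) - (p + q)) \<alpha> * (LINT u|subspace_lborel ?X. LINT x|lborel. F u x)"
    by (rule integral_mult_right_zero)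
  also have "(LINT u|subspace_lborel ?X. LINT x|lborel. F u x) = (LINT x|lborel. LINT u|subspace_lborel ?X. F u x)"
    by (rule Fubini_integral[OF F_int, symmetric])
  also have "\<dots> = (LINT x|lborel. fibre_const l b * (f x * complex_of_real (gap Q x) powr (b + of_nat l)))"
  proof (rule integral_cong_AE)
    show "AE x in lborel. (LINT u|subspace_lborel ?X. F u x) =
        fibre_const l b * (f x * complex_of_real (gap Q x) powr (b + of_nat l))"
      using AE_gap_pos[OF Q]
    proof eventually_elim
      fix x assume gap: "gap Q x > 0"
      have "AE u in subspace_lborel ?X. complex_of_real (plane_dist P Q u x) powr b =
        complex_of_real (sqrt ((norm (u - proj ?X x))\<^sup>2 + (gap Q x)\<^sup>2)) powr b"
        using AE_subspace_lborel[OF fibre_space(1)[OF P]] by eventually_elim (simp add: plane_dist_eq[OF P Q])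
      then have "(LINT u|subspace_lborel ?X. complex_of_real (plane_dist P Q u x) powr b) =
          (LINT u|subspace_lborel ?X. complex_of_real (sqrt ((norm (u - proj ?X x))\<^sup>2 + (gap Q x)\<^sup>2)) powr b)"
        by (intro integral_cong_AE) measurable
      also have "\<dots> = fibre_const l b * of_real (gap Q x) powr (b + of_nat l)"
        by (rule has_bochner_integral_integral_eq,
            rule has_bochner_integral_fibre[OF fibre_space[OF P] l proj_in[OF fibre_space(1)[OF P]] gap b])
      finally show "(LINT u|subspace_lborel ?X. F u x) =
        fibre_const l b * (f x * complex_of_real (gap Q x) powr (b + of_nat l))"
        by (simp add: F_def mult_ac)
    qed
    show "(\<lambda>x. LINT u|subspace_lborel ?X. F u x) \<in> borel_measurable lborel"
      using integrable_snd[OF F_int] by (rule borel_measurable_integrable)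
  qed measurable
  finally show ?thesis by (simp add: mult.assoc)
qed

text \<open>The complex integral over \<open>u\<close> is evaluated for almost every \<open>Q\<close> only; measurability in \<open>Q\<close> is what
allows the exceptional set to be ignored, because the Bochner integral of a function that is not
measurable is \<open>0\<close> by convention. It is proved by writing the integral over the varying space
\<open>P\<^sup>\<bottom> \<inter> \<eta>\<close> as a weighted integral over the whole space.\<close>
lemma integral_over_P_measurable:
  "(\<lambda>Q. LINT P|MP. LINT u|subspace_lborel (P\<^sup>\<bottom> \<inter> \<eta>). semyanistyi (p + q) \<alpha> f (join_plane P Q (u + v)))
     \<in> borel_measurable MQ"
proof -
  define H where "H Q P w = (exp (- (norm (w - (proj \<eta> w - proj P w)))\<^sup>2) / sqrt pi ^ (CARD('n) - l)) *\<^sub>R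
    (1 / riesz_gamma (CARD('n) - (p + q)) \<alpha> *
      (LINT x|lborel. f x * complex_of_real (plane_dist P Q (proj \<eta> w - proj P w) x) powr b))" for Q P w
  note [measurable] = proj_measurable[OF \<eta>(1)] plane_dist_measurable
  have [measurable]: "(\<lambda>z. proj (snd (fst z)) (snd z)) \<in> borel_measurable ((MQ \<Otimes>\<^sub>M MP) \<Otimes>\<^sub>M lborel)"
  proof -
    have "(\<lambda>z. snd (fst z)) \<in> ((MQ \<Otimes>\<^sub>M MP) \<Otimes>\<^sub>M (lborel :: (real^'n) measure)) \<rightarrow>\<^sub>M MP" by measurable
    then have "(\<lambda>z. snd (fst z)) \<in> ((MQ \<Otimes>\<^sub>M MP) \<Otimes>\<^sub>M (lborel :: (real^'n) measure)) \<rightarrow>\<^sub>M grassmannian_borel \<eta> p"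
      by (simp add: measurable_cong_sets[OF refl P.sets_M])
    then show ?thesis by (rule proj_grassmannian_measurable) measurable
  qed
  have "(\<lambda>z. H (fst (fst z)) (snd (fst z)) (snd z)) \<in> borel_measurable ((MQ \<Otimes>\<^sub>M MP) \<Otimes>\<^sub>M lborel)"
    unfolding H_def by measurable
  then have H_meas: "(\<lambda>Q. LINT P|MP. LINT w|lborel. H Q P w) \<in> borel_measurable MQ"
    by measurable
  have inner_eq: "(LINT u|subspace_lborel (P\<^sup>\<bottom> \<inter> \<eta>). semyanistyi (p + q) \<alpha> f (join_plane P Q (u + v))) =
      (LINT w|lborel. H Q P w)" if P: "P \<in> space MP" and Q: "Q \<in> space MQ" for P Q
  proof -
    note [measurable] = plane_dist_measurable_fixed[OF P Q]
    have "(LINT u|subspace_lborel (P\<^sup>\<bottom> \<inter> \<eta>). semyanistyi (p + q) \<alpha> f (join_plane P Q (u + v))) =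
        (LINT u|subspace_lborel (P\<^sup>\<bottom> \<inter> \<eta>). 1 / riesz_gamma (CARD('n) - (p + q)) \<alpha> *
          (LINT x|lborel. f x * complex_of_real (plane_dist P Q u x) powr b))"
      unfolding semyanistyi_borel(2)[OF f] infdist_plane[OF P Q] b_def ..
    also have "\<dots> = (LINT w|lborel. H Q P w)"
      using P.in_M[OF P] \<eta>(1)
      by (subst integral_subspace_lborel[OF fibre_space(1)[OF P]])
         (simp_all add: H_def[abs_def] gauss_weight_def fibre_space(2)[OF P] proj_relative_complement)
    finally show ?thesis .
  qed
  have outer_eq: "(LINT P|MP. LINT u|subspace_lborel (P\<^sup>\<bottom> \<inter> \<eta>). semyanistyi (p + q) \<alpha> f (join_plane P Q (u + v))) =
      (LINT P|MP. LINT w|lborel. H Q P w)" if "Q \<in> space MQ" for Q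
    by (rule Bochner_Integration.integral_cong[OF refl]) (rule inner_eq, simp_all add: that)
  show ?thesis by (subst measurable_cong[OF outer_eq]) (simp_all add: H_meas)
qed

text \<open>For almost every \<open>Q\<close> the integral over \<open>x\<close> and \<open>u\<close> converges absolutely, and this suffices since
exceptional \<open>Q\<close> form a null set.\<close>
lemma strichartz_eq:
  assumes G: "G \<eta> p = MP" "G (\<eta>\<^sup>\<bottom>) q = MQ"
    and fin: "semyanistyi_nn (p + l) (of_nat q + \<alpha>) f ((+) v ` \<eta>) < \<infinity>"
  shows "strichartz G p q (semyanistyi (p + q) \<alpha> f) \<eta> v =
    1 / riesz_gamma (CARD('n) - (p + q)) \<alpha> * fibre_const l b * Q.average_const (b + of_nat l) *
      (LINT x|lborel. f x * complex_of_real (norm (offset x)) powr (b + of_nat l))"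
proof -
  let ?c = "1 / riesz_gamma (CARD('n) - (p + q)) \<alpha> * fibre_const l b"
  define F where "F x Q = f x * complex_of_real (gap Q x) powr (b + of_nat l)" for x Q
  have [measurable]: "case_prod F \<in> borel_measurable (lborel \<Otimes>\<^sub>M MQ)" unfolding F_def by measurable
  have fin': "(\<integral>\<^sup>+Q. \<integral>\<^sup>+x. ennreal (norm (f x) * gap Q x powr (Re b + l)) \<partial>lborel \<partial>MQ) < \<infinity>"
    unfolding nn_integral_over_transversals using fin by (simp add: ennreal_mult_less_top)
  have F_int: "integrable (lborel \<Otimes>\<^sub>M MQ) (case_prod F)"
  proof (rule integrableI_bounded)
    have "(\<integral>\<^sup>+z. ennreal (norm (case_prod F z)) \<partial>(lborel \<Otimes>\<^sub>M MQ)) =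
        (\<integral>\<^sup>+Q. \<integral>\<^sup>+x. ennreal (norm (case_prod F (x, Q))) \<partial>lborel \<partial>MQ)"
      by (rule Q.nn_integral_snd[symmetric]) measurable
    also have "\<dots> = (\<integral>\<^sup>+Q. \<integral>\<^sup>+x. ennreal (norm (f x) * gap Q x powr (Re b + l)) \<partial>lborel \<partial>MQ)"
      by (simp add: F_def norm_mult norm_of_real_powr gap_nonneg)
    finally show "(\<integral>\<^sup>+z. ennreal (norm (case_prod F z)) \<partial>(lborel \<Otimes>\<^sub>M MQ)) < \<infinity>" using fin' by simp
  qed measurable
  have "AE Q in MQ. (\<integral>\<^sup>+x. ennreal (norm (f x) * gap Q x powr (Re b + l)) \<partial>lborel) \<noteq> \<infinity>"
    using fin' by (intro nn_integral_PInf_AE) (auto simp: less_top)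
  then have ae: "AE Q in MQ. (LINT P|MP. LINT u|subspace_lborel (P\<^sup>\<bottom> \<inter> \<eta>). semyanistyi (p + q) \<alpha> f (join_plane P Q (u + v))) =
      ?c * (LINT x|lborel. F x Q)"
    using AE_space
  proof eventually_elim
    fix Q assume Q: "Q \<in> space MQ" and "(\<integral>\<^sup>+x. ennreal (norm (f x) * gap Q x powr (Re b + l)) \<partial>lborel) \<noteq> \<infinity>"
    then have "(LINT u|subspace_lborel (P\<^sup>\<bottom> \<inter> \<eta>). semyanistyi (p + q) \<alpha> f (join_plane P Q (u + v))) =
        ?c * (LINT x|lborel. F x Q)" if "P \<in> space MP" for P
      unfolding F_def using that by (intro integral_over_fibre) (auto simp: less_top)
    then have "(LINT P|MP. LINT u|subspace_lborel (P\<^sup>\<bottom> \<inter> \<eta>). semyanistyi (p + q) \<alpha> f (join_plane P Q (u + v))) =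
        (LINT P|MP. ?c * (LINT x|lborel. F x Q))"
      by (rule Bochner_Integration.integral_cong[OF refl])
    then show "(LINT P|MP. LINT u|subspace_lborel (P\<^sup>\<bottom> \<inter> \<eta>). semyanistyi (p + q) \<alpha> f (join_plane P Q (u + v))) =
      ?c * (LINT x|lborel. F x Q)" by (simp add: P.prob_space)
  qed
  have "strichartz G p q (semyanistyi (p + q) \<alpha> f) \<eta> v = (LINT Q|MQ. ?c * (LINT x|lborel. F x Q))"
    unfolding strichartz_def G
  proof (rule integral_cong_AE[OF integral_over_P_measurable _ ae])
    have "(\<lambda>Q. LINT x|lborel. F x Q) \<in> borel_measurable MQ"
      using Q.integrable_snd[OF F_int] by (rule borel_measurable_integrable)
    then show "(\<lambda>Q. ?c * (LINT x|lborel. F x Q)) \<in> borel_measurable MQ" by measurable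
  qed
  also have "\<dots> = ?c * (LINT Q|MQ. LINT x|lborel. F x Q)" by (rule integral_mult_right_zero)
  also have "(LINT Q|MQ. LINT x|lborel. F x Q) = (LINT x|lborel. LINT Q|MQ. F x Q)"
    by (rule Q.Fubini_integral[OF F_int])
  also have "\<dots> = (LINT x|lborel. Q.average_const (b + of_nat l) * (f x * complex_of_real (norm (offset x)) powr (b + of_nat l)))"
  proof (rule Bochner_Integration.integral_cong[OF refl])
    fix x
    have "(LINT Q|MQ. complex_of_real (gap Q x) powr (b + of_nat l)) =
        Q.average_const (b + of_nat l) * of_real (norm (offset x)) powr (b + of_nat l)"
      unfolding gap_def using exponent_ok
      by (intro has_bochner_integral_integral_eq Q.has_bochner_integral_average offset_in) simp
    then show "(LINT Q|MQ. F x Q) = Q.average_const (b + of_nat l) * (f x * complex_of_real (norm (offset x)) powr (b + of_nat l))"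
      by (simp add: F_def mult_ac)
  qed
  finally show ?thesis by (simp add: mult.assoc)
qed

text \<open>All Gamma factors that contain \<open>\<alpha>\<close> cancel against the two normalising factors. Since
\<open>l - (n - j) = q - (n - k)\<close>, the powers of \<open>2\<close> and \<open>\<pi>\<close> leave \<open>2^q * \<pi>^(q/2)\<close>.\<close>
lemma normalising_constants:
  "1 / riesz_gamma (CARD('n) - (p + q)) \<alpha> * fibre_const l b * Q.average_const (b + of_nat l) =
    complex_of_real (2 ^ q * pi powr (real q / 2) * Gamma ((real CARD('n) - real (p + l)) / 2)
       / Gamma ((real CARD('n) - real (p + l) - real q) / 2)) *
    (1 / riesz_gamma (CARD('n) - (p + l)) (of_nat q + \<alpha>))"
proof -
  define gN where "gN = Gamma ((real CARD('n) - real (p + l)) / 2)"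
  define gNq where "gNq = Gamma ((real CARD('n) - real (p + l) - real q) / 2)"
  define g1 where "g1 = Gamma (\<alpha> / 2)"
  define g2 where "g2 = Gamma (- b / 2)"
  define g3 where "g3 = Gamma (- (b + of_nat l) / 2)"
  define g4 where "g4 = Gamma ((of_nat q + \<alpha>) / 2)"
  have nz: "gN \<noteq> 0" "gNq \<noteq> 0" "g1 \<noteq> 0" "g2 \<noteq> 0" "g3 \<noteq> 0" "g4 \<noteq> 0"
    using n b \<alpha> unfolding gN_def gNq_def g1_def g2_def g3_def g4_def
    by (auto intro!: Gamma_nonzero_of_Re_pos less_imp_neq[OF Gamma_real_pos, symmetric] simp: add_pos_nonneg)
  have le: "p + q \<le> CARD('n)" "p + l \<le> CARD('n)" "q \<le> N" using n qN by auto
  have r1: "riesz_gamma (CARD('n) - (p + q)) \<alpha> = 2 powr \<alpha> * of_real (pi powr ((real CARD('n) - p - q) / 2)) * g1 / g2"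
    using le by (simp add: riesz_gamma_def g1_def g2_def b_def of_nat_diff algebra_simps)
  have r2: "riesz_gamma (CARD('n) - (p + l)) (of_nat q + \<alpha>) =
      2 ^ q * 2 powr \<alpha> * of_real (pi powr ((real CARD('n) - p - l) / 2)) * g4 / g3"
    using le by (simp add: riesz_gamma_def g3_def g4_def b_def of_nat_diff powr_add algebra_simps)
  have c1: "fibre_const l b = of_real (pi powr (l / 2)) * g3 / g2" by (simp add: fibre_const_def g2_def g3_def)
  have gammas: "Gamma (complex_of_nat N / 2) = of_real gN" "Gamma (complex_of_nat (N - q) / 2) = of_real gNq"
    unfolding gN_def gNq_def using le qN by (simp_all add: N_def of_nat_diff diff_diff_eq flip: Gamma_complex_of_real)
  have args: "(of_nat (N - q) + (b + of_nat l)) / 2 = \<alpha> / 2" "(of_nat N + (b + of_nat l)) / 2 = (of_nat q + \<alpha>) / 2"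
    using le by (simp_all add: b_def N_def of_nat_diff)
  have c2: "Q.average_const (b + of_nat l) = (g1 * of_real gN) / (of_real gNq * g4)"
    unfolding Q.average_const_def gauss_moment_def g1_def g4_def by (simp only: args gammas) simp
  have pi_eq: "pi powr (l / 2) * pi powr ((real CARD('n) - p - l) / 2) =
      pi powr (real q / 2) * pi powr ((real CARD('n) - p - q) / 2)"
    by (simp add: powr_add[symmetric] field_simps)
  then have pi_eq': "complex_of_real (pi powr (l / 2)) * of_real (pi powr ((real CARD('n) - p - l) / 2)) =
      of_real (pi powr (real q / 2)) * of_real (pi powr ((real CARD('n) - p - q) / 2))"
    by (metis of_real_mult)
  define A B C D where "A = complex_of_real (pi powr (l / 2))" "B = complex_of_real (pi powr ((real CARD('n) - p - l) / 2))"
    "C = complex_of_real (pi powr (real q / 2))" "D = complex_of_real (pi powr ((real CARD('n) - p - q) / 2))"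
  define z where "z = (2 :: complex) powr \<alpha>"
  have AB: "A * B = C * D" using pi_eq' by (simp add: A_B_C_D_def)
  have nz': "B \<noteq> 0" "D \<noteq> 0" "z \<noteq> 0" by (simp_all add: A_B_C_D_def z_def)
  have "1 / (z * D * g1 / g2) * (A * g3 / g2) * ((g1 * of_real gN) / (of_real gNq * g4)) =
    2 ^ q * C * of_real gN / of_real gNq * (1 / (2 ^ q * z * B * g4 / g3))"
    using nz nz' AB by (simp add: field_simps)
  then show ?thesis
    unfolding r1 r2 c1 c2 gN_def[symmetric] gNq_def[symmetric] A_B_C_D_def[symmetric] z_def[symmetric]
    by (simp add: A_B_C_D_def)
qed

end

end

end

lemma semyanistyi_null:
  assumes f: "f \<in> borel_measurable borel" and ae: "AE x in lborel. f x = 0"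
  shows "semyanistyi_nn m \<alpha> f = (\<lambda>_. 0)" "semyanistyi m \<alpha> f = (\<lambda>_. 0)"
proof -
  have f': "f \<in> borel_measurable lebesgue" using f by (simp add: measurable_completion)
  have "AE x in lebesgue. f x = (\<lambda>_. 0) x" using AE_completion[OF ae] by simp
  from semyanistyi_cong_AE[OF f' _ this]
  show "semyanistyi_nn m \<alpha> f = (\<lambda>_. 0)" "semyanistyi m \<alpha> f = (\<lambda>_. 0)"
    by (simp_all add: semyanistyi_nn_def[abs_def] semyanistyi_def[abs_def] semyanistyi_integrand_def[abs_def])
qed

theorem theorem5p7:
  fixes f :: "real^'n \<Rightarrow> complex" and \<alpha> :: complex and n p q l j k :: nat
    and G :: "(real^'n) set \<Rightarrow> nat \<Rightarrow> (real^'n) set measure"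
    and \<eta> :: "(real^'n) set" and v :: "real^'n"
  assumes "n = CARD('n)" "p > 0" "q > 0" "l > 0" "p + q + l < n" "j = p + q" "k = p + l"
    and "\<And>X m. subspace X \<Longrightarrow> m \<le> dim X \<Longrightarrow> invariant_grassmann_measure X m (G X m)"
    and "semyanistyi_admissible n j \<alpha>" "semyanistyi_admissible n k (of_nat q + \<alpha>)"
    and "f \<in> borel_measurable lebesgue"
    and "\<eta> \<in> grassmannian UNIV k" "v \<in> \<eta>\<^sup>\<bottom>"
    and "strichartz_nn G p q (semyanistyi_nn j \<alpha> f) \<eta> v < \<infinity> \<or>
         (semyanistyi_nn k (of_nat q + \<alpha>) f ((+) v ` \<eta>) < \<infinity> \<and> Re \<alpha> < real n - real k - real q)"
  shows "strichartz_nn G p q (semyanistyi_nn j \<alpha> f) \<eta> v < \<infinity> \<and>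
         semyanistyi_nn k (of_nat q + \<alpha>) f ((+) v ` \<eta>) < \<infinity> \<and>
         strichartz G p q (semyanistyi j \<alpha> f) \<eta> v =
           complex_of_real (2 ^ q * pi powr (real q / 2) * Gamma ((real n - real k) / 2)
                              / Gamma ((real n - real k - real q) / 2))
           * semyanistyi k (of_nat q + \<alpha>) f ((+) v ` \<eta>)"
proof -
  obtain g where g: "g \<in> borel_measurable borel" "AE x in lebesgue. f x = g x"
    using lebesgue_ex_borel_complex[OF assms(11)] by blast
  note fg = semyanistyi_cong_AE[OF assms(11) g]
  have \<eta>: "subspace \<eta>" "dim \<eta> = p + l" using assms(7,12) by (auto simp: grassmannian_def)
  have dimE: "dim (\<eta>\<^sup>\<bottom>) = n - (p + l)"
    using dim_relative_complement[OF \<eta>(1) subspace_UNIV] \<eta>(2) assms(1) by simp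
  interpret strichartz_setting \<eta> v p q l "G \<eta> p" "G (\<eta>\<^sup>\<bottom>) q"
    using \<eta> dimE assms by unfold_locales (auto simp: subspace_orthogonal_comp)
  define b where "b = \<alpha> + of_nat (p + q) - of_nat CARD('n)"
  have \<alpha>: "Re \<alpha> > 0" using assms(9) by (simp add: semyanistyi_admissible_def)
  have b_iff: "Re b + real l < 0 \<longleftrightarrow> Re \<alpha> < real n - real k - real q"
    using assms(1,7) by (auto simp: b_def)
  show ?thesis
  proof (cases "Re b + real l < 0")
    case True
    note b = True[unfolded b_def]
    define K where "K = Re (fibre_const l (of_real (Re b))) * Re (Q.average_const (of_real (Re b + l)))"
    have K: "K > 0"
      unfolding K_def
      using fibre_const_pos[OF True] Q.nn_integral_average(2)[OF offset_in, of "Re b + l"] exponent_ok[OF g(1) b \<alpha>]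
      by (simp add: b_def)
    have nn: "strichartz_nn G p q (semyanistyi_nn j \<alpha> g) \<eta> v = ennreal K * semyanistyi_nn k (of_nat q + \<alpha>) g ((+) v ` \<eta>)"
      using strichartz_nn_eq[OF g(1) b \<alpha> refl refl] by (simp add: assms(6,7) K_def b_def)
    have fin: "semyanistyi_nn k (of_nat q + \<alpha>) g ((+) v ` \<eta>) < \<infinity>"
      using assms(14) K unfolding fg nn by (auto simp: ennreal_mult_less_top)
    moreover have "strichartz_nn G p q (semyanistyi_nn j \<alpha> g) \<eta> v < \<infinity>"
      using fin unfolding nn by (simp add: ennreal_mult_less_top)
    moreover have "strichartz G p q (semyanistyi j \<alpha> g) \<eta> v =
           complex_of_real (2 ^ q * pi powr (real q / 2) * Gamma ((real n - real k) / 2)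
                              / Gamma ((real n - real k - real q) / 2))
           * semyanistyi k (of_nat q + \<alpha>) g ((+) v ` \<eta>)"
    proof -
      have e: "of_nat q + \<alpha> + of_nat (p + l) - of_nat CARD('n) = b + of_nat l" by (simp add: b_def)
      have "semyanistyi k (of_nat q + \<alpha>) g ((+) v ` \<eta>) = 1 / riesz_gamma (CARD('n) - (p + l)) (of_nat q + \<alpha>) *
        (LINT x|lborel. g x * complex_of_real (norm (offset x)) powr (b + of_nat l))"
        unfolding assms(7) semyanistyi_borel(2)[OF g(1)] infdist_base_plane e ..
      moreover have "strichartz G p q (semyanistyi j \<alpha> g) \<eta> v =
        complex_of_real (2 ^ q * pi powr (real q / 2) * Gamma ((real CARD('n) - real (p + l)) / 2)
           / Gamma ((real CARD('n) - real (p + l) - real q) / 2)) *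
        (1 / riesz_gamma (CARD('n) - (p + l)) (of_nat q + \<alpha>)) *
        (LINT x|lborel. g x * complex_of_real (norm (offset x)) powr (b + of_nat l))"
        using strichartz_eq[OF g(1) b \<alpha> refl refl] fin
        unfolding normalising_constants[OF g(1) b \<alpha>] assms(6,7) b_def by blast
      ultimately show ?thesis unfolding assms(1,7) by (simp only: mult.assoc)
    qed
    ultimately show ?thesis unfolding fg by blast
  next
    case False
    then have "strichartz_nn G p q (semyanistyi_nn j \<alpha> g) \<eta> v < \<infinity>"
      using assms(14) b_iff unfolding fg by blast
    then have "AE x in lborel. g x = 0"
      using AE_zero_if_strichartz_nn_finite[where f = g and \<alpha> = \<alpha> and G = G, OF g(1) refl refl] False by (simp add: assms(6) b_def not_less)
    note null = semyanistyi_null[OF g(1) this]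
    show ?thesis unfolding fg null by (simp add: strichartz_nn_def strichartz_def)
  qed
qed

end
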